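(* Let $K$ be a field, $R=K[x_1,\dots,x_n]$, and let $I\subset R$ be a (nonzero proper) monomial ideal without embedded associated primes with minimal irreducible decomposition $I=\mathfrak{q}_1\cap\cdots\cap\mathfrak{q}_r$, where $\mathfrak{q}_j=\langle x_i^{w_{j,i}} : i\in A_j\rangle$ with $A_j\subset[n]$ and $w_{j,i}$ positive integers. Assume that $\mathrm{ht}(\mathfrak{p})=2$ for all $\mathfrak{p}\in\mathrm{Ass}(I)$. Then $I$ is a Simis ideal if and only if there exist a Simis squarefree monomial ideal $J\subset R$ and a standard linear weighting $w$ such that $I=J_w$.
   Context: $[n]=\{1,\dots,n\}$; $\mathbb{N}$ is the set of non-negative integers. For $a\in\mathbb{N}^n$, $x^a=x_1^{a_1}\cdots x_n^{a_n}$. Minimal irreducible decomposition: $I=\mathfrak{q}_1\cap\cdots\cap\mathfrak{q}_r$ where each $\mathfrak{q}_j$ is an irreducible monomial ideal (i.e. of the form $\langle x_i^{w_{j,i}} : i\in A_j\rangle$ with $\emptyset\ne A_j\subset[n]$, $w_{j,i}\ge1$), the radicals $\mathfrak{p}_j=\sqrt{\mathfrak{q}_j}=\langle x_i: i\in A_j\rangle$ are pairwise distinct, and the intersection is irredundant; thus $\mathrm{Ass}(I)=\{\mathfrak{p}_1,\dots,\mathfrak{p}_r\}$. It is assumed that $I$ admits such a decomposition. An embedded prime is an associated prime properly containing another associated prime. For $s\ge1$, $I^{(s)}=\bigcap_{\mathfrak{p}\in \mathrm{Ass}(I)}(I^sR_{\mathfrak{p}}\cap R)$. A monomial ideal $I$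 is a Simis ideal if $I^{(s)}=I^s$ for all $s\ge1$. A standard linear weighting is a tuple $w=(w_1,\dots,w_n)$ of positive integers, acting by $w(a)=(w_1a_1,\dots,w_na_n)$; for a monomial ideal $J\subset R$, $J_w=\langle x^{w(a)} : x^a\in J\rangle$. *)

theory Defs
  imports
    "HOL-Library.Poly_Mapping"
    "HOL-Library.Extended_Nat"
    "HOL-Computational_Algebra.Fraction_Field"
    "HOL-Algebra.Ideal_Product"
    "HOL-Algebra.Algebraic_Closure_Type"
begin

section \<open>Ideals of a commutative ring\<close>

definition radical_ideal :: "('a, 'b) ring_scheme \<Rightarrow> 'a set \<Rightarrow> 'a set" where
  "radical_ideal R I = {f \<in> carrier R. \<exists>m::nat. f [^]\<^bsub>R\<^esub> m \<in> I}"

text \<open>The associated primes of \<open>R / I\<close>: the prime ideals of the form \<open>(I : f)\<close>.\<close>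

definition associated_primes :: "('a, 'b) ring_scheme \<Rightarrow> 'a set \<Rightarrow> 'a set set" where
  "associated_primes R I =
     {p. primeideal p R \<and> (\<exists>f \<in> carrier R. p = {g \<in> carrier R. g \<otimes>\<^bsub>R\<^esub> f \<in> I})}"

definition embedded_primes :: "('a, 'b) ring_scheme \<Rightarrow> 'a set \<Rightarrow> 'a set set" where
  "embedded_primes R I = {p \<in> associated_primes R I. \<exists>p' \<in> associated_primes R I. p' \<subset> p}"

text \<open>The supremum of the lengths of chains \<open>P 0 \<subset> \<dots> \<subset> P k = p\<close> of prime ideals.\<close>

definition height :: "('a, 'b) ring_scheme \<Rightarrow> 'a set \<Rightarrow> enat" where
  "height R p = Sup {enat k | k. \<exists>P. P k = p \<and> (\<forall>i\<le>k. primeideal (P i) R) \<and>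
                                     (\<forall>i<k. P i \<subset> P (Suc i))}"

section \<open>Symbolic powers in a domain\<close>

abbreviation type_ring :: "'a::comm_ring_1 ring" where
  "type_ring \<equiv> ring_of_type_algebra"

text \<open>The power is taken in the multiplicative monoid of all ideals, with the ideal product.\<close>

definition ideal_power :: "'a::comm_ring_1 set \<Rightarrow> nat \<Rightarrow> 'a set" where
  "ideal_power I s = I [^]\<^bsub>ideals_set type_ring\<^esub> s"

text \<open>The localization of a domain at a prime ideal, as a subring of the fraction field.
  As \<open>0 \<in> p\<close>, the junk value \<open>Fract a 0 = 0\<close> does not occur.\<close>

definition localization_at :: "'a::idom set \<Rightarrow> 'a fract ring" where
  "localization_at p = type_ring\<lparr>carrier := {Fract a b | a b. b \<notin> p}\<rparr>"

definition extension_at :: "'a::idom set \<Rightarrow> 'a set \<Rightarrow> 'a fract set" where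
  "extension_at p I = genideal (localization_at p) ((\<lambda>f. Fract f 1) ` I)"

text \<open>Intersecting with the ring means pulling back along the embedding \<open>f \<mapsto> f / 1\<close>.\<close>

definition symbolic_power :: "'a::idom set \<Rightarrow> nat \<Rightarrow> 'a set" where
  "symbolic_power I s =
     (\<Inter>p \<in> associated_primes type_ring I. {f. Fract f 1 \<in> extension_at p (ideal_power I s)})"

section \<open>Monomial ideals\<close>

text \<open>Polynomials over \<open>'k\<close> in the variables \<open>x\<^sub>i\<close>, where \<open>i\<close> ranges over the finite type \<open>'n\<close>.
  The linear order on \<open>'n\<close>, which exists on every finite type, is only used by the
  library to make \<open>mpoly\<close> an instance of \<open>idom\<close>.\<close>

type_synonym ('n, 'k) mpoly = "('n \<Rightarrow>\<^sub>0 nat) \<Rightarrow>\<^sub>0 'k"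

definition xmon :: "('n \<Rightarrow>\<^sub>0 nat) \<Rightarrow> ('n::{finite,linorder}, 'k::field) mpoly" where
  "xmon a = Poly_Mapping.single a 1"

definition monomial_ideal_gen ::
    "('n \<Rightarrow>\<^sub>0 nat) set \<Rightarrow> ('n::{finite,linorder}, 'k::field) mpoly set" where
  "monomial_ideal_gen M = genideal type_ring (xmon ` M)"

definition monomial_ideal :: "('n::{finite,linorder}, 'k::field) mpoly set \<Rightarrow> bool" where
  "monomial_ideal I \<longleftrightarrow> (\<exists>M. I = monomial_ideal_gen M)"

definition squarefree_monomial_ideal :: "('n::{finite,linorder}, 'k::field) mpoly set \<Rightarrow> bool" where
  "squarefree_monomial_ideal I \<longleftrightarrow>
     (\<exists>M. (\<forall>a \<in> M. \<forall>i. Poly_Mapping.lookup a i \<le> 1) \<and> I = monomial_ideal_gen M)"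

definition simis_ideal :: "('n::{finite,linorder}, 'k::field) mpoly set \<Rightarrow> bool" where
  "simis_ideal I \<longleftrightarrow> monomial_ideal I \<and> (\<forall>s\<ge>1. symbolic_power I s = ideal_power I s)"

text \<open>The ideal generated by the pure powers \<open>x\<^sub>i ^ u i\<close> with \<open>i \<in> A\<close>; the values of \<open>u\<close>
  outside \<open>A\<close> are irrelevant.\<close>

definition irreducible_monomial_ideal ::
    "'n set \<Rightarrow> ('n \<Rightarrow> nat) \<Rightarrow> ('n::{finite,linorder}, 'k::field) mpoly set" where
  "irreducible_monomial_ideal A u = monomial_ideal_gen ((\<lambda>i. Poly_Mapping.single i (u i)) ` A)"

definition minimal_irreducible_decomposition ::
    "('n::{finite,linorder}, 'k::field) mpoly set \<Rightarrow> nat \<Rightarrow> (nat \<Rightarrow> 'n set) \<Rightarrow>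
     (nat \<Rightarrow> 'n \<Rightarrow> nat) \<Rightarrow> bool" where
  "minimal_irreducible_decomposition I r A w \<longleftrightarrow>
     (\<forall>j \<in> {1..r}. A j \<noteq> {} \<and> (\<forall>i \<in> A j. w j i \<ge> 1)) \<and>
     I = (\<Inter>j \<in> {1..r}. irreducible_monomial_ideal (A j) (w j)) \<and>
     inj_on (\<lambda>j. radical_ideal type_ring
                   (irreducible_monomial_ideal (A j) (w j) :: ('n, 'k) mpoly set)) {1..r} \<and>
     (\<forall>j \<in> {1..r}. I \<noteq> (\<Inter>k \<in> {1..r} - {j}. irreducible_monomial_ideal (A k) (w k)))"

section \<open>Linear weightings\<close>

definition standard_linear_weighting :: "('n \<Rightarrow> nat) \<Rightarrow> bool" where
  "standard_linear_weighting v \<longleftrightarrow> (\<forall>i. v i \<ge> 1)"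

definition weight_exponent :: "('n \<Rightarrow> nat) \<Rightarrow> ('n \<Rightarrow>\<^sub>0 nat) \<Rightarrow> ('n \<Rightarrow>\<^sub>0 nat)" where
  "weight_exponent v a = Poly_Mapping.mapp (\<lambda>i c. v i * c) a"

definition weighted_ideal ::
    "('n \<Rightarrow> nat) \<Rightarrow> ('n, 'k) mpoly set \<Rightarrow> ('n::{finite,linorder}, 'k::field) mpoly set" where
  "weighted_ideal v J = monomial_ideal_gen {weight_exponent v a | a. xmon a \<in> J}"

end

(*
  Monomial ideals are determined by their upward closed exponent sets. If the sets A_j form an
  antichain, powers of irreducible ideals on A_j are primary, and inverting the variables outside
  A_j turns I into q_j; hence I^(s) is the intersection of the q_j^s, and I is Simis iff this
  intersection equals I^s for all s. All sets involved commute with the rescaling d -> d div v,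
  so I = J_v is Simis iff J is. It remains to see that a Simis ideal has the same exponent at x in
  any two components (x^p, y^q), (x^p', z^r). If p < p', put a large exponent on every variable
  outside {x, y, z}: only the components inside {x, y, z} matter then, and an explicit monomial
  in x, y, z lies in every q_j^2 but not in I^2.
*)
theory Submission
  imports Defs
begin

section \<open>Ideals of a type ring\<close>

text \<open>The weights are compared through a = max(2p, p'). It is just large enough for x^a to lie
  in the square of the first component at x and, times z^r, in the square of the second; yet it is
  smaller than p + p', because 1 <= p < p'. In a product of two members of I, too little y (b < q)
  forces x^p into both factors, and too little z (c < 2r) forces x^p' into one of them, which
  together exceed a. So the obstruction is already visible in the squares. The difficulty is a third
  component (y^q', z^r'): b and c must respect these bounds and still suffice for its square. If
  this fails at x, the argument is tried at y and z; if it fails everywhere, the inequalities leave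
  two tight families, each with a monomial of its own. Conversely, J comes as a bare ideal without a
  decomposition. Its components are recovered from those of I by comparing supports, and only then
  does it follow that the exponents of I can be taken from one weighting.\<close>

lemma type_ring_simps [simp]:
  "carrier (type_ring :: 'a::comm_ring_1 ring) = UNIV"
  "monoid.mult (type_ring :: 'a ring) = (*)"
  "ring.add (type_ring :: 'a ring) = (+)"
  "one (type_ring :: 'a ring) = 1"
  "ring.zero (type_ring :: 'a ring) = 0"
  by (auto simp: ring_of_type_algebra_def)

lemma nat_pow_type_ring [simp]: "(a::'a::comm_ring_1) [^]\<^bsub>type_ring\<^esub> (m::nat) = a ^ m"
  by (induction m) (auto simp: mult.commute)

lemma a_inv_type_ring [simp]: "a_inv type_ring (a::'a::comm_ring_1) = - a"
proof -
  interpret cring "type_ring :: 'a ring" by (rule cring_from_type_algebra)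
  show ?thesis using minus_equality[of "- a" a] by simp
qed

lemma ideal_type_ring_iff:
  "ideal J (type_ring :: 'a::comm_ring_1 ring) \<longleftrightarrow>
     0 \<in> J \<and> (\<forall>a\<in>J. \<forall>b\<in>J. a + b \<in> J) \<and> (\<forall>a\<in>J. \<forall>x. x * a \<in> J)"
proof
  assume "ideal J (type_ring :: 'a ring)"
  then interpret ideal J "type_ring :: 'a ring" .
  show "0 \<in> J \<and> (\<forall>a\<in>J. \<forall>b\<in>J. a + b \<in> J) \<and> (\<forall>a\<in>J. \<forall>x. x * a \<in> J)"
    using additive_subgroup.zero_closed[OF is_additive_subgroup]
      additive_subgroup.a_closed[OF is_additive_subgroup] I_l_closed by auto
next
  assume J: "0 \<in> J \<and> (\<forall>a\<in>J. \<forall>b\<in>J. a + b \<in> J) \<and> (\<forall>a\<in>J. \<forall>x. x * a \<in> J)"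
  interpret cring "type_ring :: 'a ring" by (rule cring_from_type_algebra)
  have neg: "- a \<in> J" if "a \<in> J" for a
    using J that mult_minus1[of a] by metis
  show "ideal J (type_ring :: 'a ring)"
  proof (rule idealI)
    show "subgroup J (add_monoid (type_ring :: 'a ring))"
    proof (rule add.subgroupI)
      show "a_inv type_ring a \<in> J" if "a \<in> J" for a
        unfolding a_inv_type_ring using neg[OF that] .
    qed (use J in auto)
  qed (use J in \<open>auto simp: mult.commute ring_axioms\<close>)
qed

lemma primeideal_type_ring_iff:
  "primeideal J (type_ring :: 'a::comm_ring_1 ring) \<longleftrightarrow>
     ideal J type_ring \<and> J \<noteq> UNIV \<and> (\<forall>a b. a * b \<in> J \<longrightarrow> a \<in> J \<or> b \<in> J)"
proof
  assume "primeideal J (type_ring :: 'a ring)"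
  then interpret primeideal J "type_ring :: 'a ring" .
  show "ideal J type_ring \<and> J \<noteq> UNIV \<and> (\<forall>a b. a * b \<in> J \<longrightarrow> a \<in> J \<or> b \<in> J)"
    using I_prime I_notcarr is_ideal by auto
next
  assume "ideal J type_ring \<and> J \<noteq> UNIV \<and> (\<forall>a b. a * b \<in> J \<longrightarrow> a \<in> J \<or> b \<in> J)"
  then show "primeideal J (type_ring :: 'a ring)"
    by (intro primeidealI) (auto intro: cring_from_type_algebra)
qed

lemma ideal_sum_mem:
  assumes "ideal J (type_ring :: 'a::comm_ring_1 ring)" "\<And>x. x \<in> T \<Longrightarrow> f x \<in> J"
  shows "sum f T \<in> J"
proof -
  have "0 \<in> J" "\<And>a b. a \<in> J \<Longrightarrow> b \<in> J \<Longrightarrow> a + b \<in> J"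
    using assms(1) unfolding ideal_type_ring_iff by blast+
  then show ?thesis
    using assms(2) by (induction T rule: infinite_finite_induct) simp_all
qed

lemma ideal_power_Suc: "ideal_power J (Suc s) = ideal_prod type_ring (ideal_power J s) J"
  and ideal_power_0: "ideal_power (J :: 'a::comm_ring_1 set) 0 = UNIV"
  by (simp_all add: ideal_power_def ideals_set_def)

lemma prime_one_notin:
  assumes "primeideal p (type_ring :: 'a::comm_ring_1 ring)"
  shows "1 \<notin> p"
proof
  assume "1 \<in> p"
  then have "x * 1 \<in> p" for x
    using assms unfolding primeideal_type_ring_iff ideal_type_ring_iff by blast
  then show False
    using assms unfolding primeideal_type_ring_iff by auto
qed

lemma prime_mult_notin:
  assumes "primeideal p (type_ring :: 'a::comm_ring_1 ring)" "a \<notin> p" "b \<notin> p"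
  shows "a * b \<notin> p"
  using assms unfolding primeideal_type_ring_iff by blast

lemma prime_prod_notin:
  assumes "primeideal p (type_ring :: 'a::comm_ring_1 ring)" "\<And>t. t \<in> T \<Longrightarrow> h t \<notin> p"
  shows "prod h T \<notin> p"
  using assms(2)
  by (induction T rule: infinite_finite_induct)
    (simp_all add: prime_one_notin[OF assms(1)] prime_mult_notin[OF assms(1)])

lemma prime_power_mem:
  assumes "primeideal p (type_ring :: 'a::comm_ring_1 ring)" "g ^ m \<in> p"
  shows "g \<in> p"
  using assms(2) prime_prod_notin[OF assms(1), of "{..<m}" "\<lambda>_. g"] by auto

lemma ideal_zero_mem: "ideal J (type_ring :: 'a::comm_ring_1 ring) \<Longrightarrow> 0 \<in> J"
  unfolding ideal_type_ring_iff by blast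

section \<open>Contraction from a localization\<close>

lemma ring_localization_at:
  assumes "primeideal p (type_ring :: 'a::idom ring)"
  shows "ring (localization_at p)"
proof -
  have nz: "b \<noteq> 0" if "b \<notin> p" for b
    using assms that ideal_zero_mem unfolding primeideal_type_ring_iff by blast
  note mul = prime_mult_notin[OF assms] and one = prime_one_notin[OF assms]
  define C where "C = {Fract a b | a b. b \<notin> p}"
  have C: "x + y \<in> C" "x * y \<in> C" "- x \<in> C" if xy: "x \<in> C" "y \<in> C" for x y
  proof -
    from xy obtain a b c d where *: "x = Fract a b" "b \<notin> p" "y = Fract c d" "d \<notin> p"
      unfolding C_def by blast
    have "x + y = Fract (a * d + c * b) (b * d)" "x * y = Fract (a * c) (b * d)" "- x = Fract (- a) b"
      using * nz[of b] nz[of d] by simp_all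
    then show "x + y \<in> C" "x * y \<in> C" "- x \<in> C"
      using mul[OF *(2,4)] *(2) unfolding C_def by blast+
  qed
  have C01: "0 \<in> C" "1 \<in> C"
    using one unfolding Zero_fract_def One_fract_def C_def by blast+
  have neg: "\<exists>y\<in>C. y + x = 0" if "x \<in> C" for x
    using C(3)[OF that that] by (intro bexI[of _ "- x"]) simp_all
  show ?thesis
    unfolding localization_at_def ring_of_type_algebra_def C_def[symmetric]
    by (intro ringI abelian_groupI monoidI) (use C C01 neg in \<open>simp_all add: algebra_simps\<close>)
qed

text \<open>The extended ideal is the set \<open>E\<close> of fractions with numerator in
  \<open>J\<close> and denominator outside \<open>p\<close>. Clearing denominators, which is
  reversible in a domain, removes the fraction field from everything that follows.\<close>

lemma extension_at_contraction:
  assumes p: "primeideal p (type_ring :: 'a::idom ring)" and J: "ideal J type_ring"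
  shows "{f. Fract f 1 \<in> extension_at p J} = {f. \<exists>b. b \<notin> p \<and> b * f \<in> J}"
proof -
  have nz: "b \<noteq> 0" if "b \<notin> p" for b
    using p that ideal_zero_mem unfolding primeideal_type_ring_iff by blast
  note mul = prime_mult_notin[OF p] and one = prime_one_notin[OF p] and J0 = ideal_zero_mem[OF J]
  have Jadd: "a + b \<in> J" if "a \<in> J" "b \<in> J" for a b
    using J that unfolding ideal_type_ring_iff by blast
  have Jmul: "x * a \<in> J" if "a \<in> J" for a x
    using J that unfolding ideal_type_ring_iff by blast
  interpret L: ring "localization_at p" by (rule ring_localization_at[OF p])
  have L: "carrier (localization_at p) = {Fract a b | a b. b \<notin> p}"
    "monoid.mult (localization_at p) = (*)" "ring.add (localization_at p) = (+)"
    "ring.zero (localization_at p) = 0"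
    by (auto simp: localization_at_def ring_of_type_algebra_def)
  define E where "E = {Fract a b | a b. a \<in> J \<and> b \<notin> p}"
  have Eadd: "x + y \<in> E" if xy: "x \<in> E" "y \<in> E" for x y
  proof -
    from xy obtain a b c d where *: "x = Fract a b" "a \<in> J" "b \<notin> p" "y = Fract c d" "c \<in> J" "d \<notin> p"
      unfolding E_def by blast
    have "x + y = Fract (a * d + c * b) (b * d)"
      using * nz[of b] nz[of d] by simp
    moreover have "a * d + c * b \<in> J"
      using * Jadd Jmul by (metis mult.commute)
    ultimately show ?thesis using mul * unfolding E_def by blast
  qed
  have Emul: "x * y \<in> E" if xy: "x \<in> E" "y \<in> carrier (localization_at p)" for x y
  proof -
    from xy obtain a b c d where *: "x = Fract a b" "a \<in> J" "b \<notin> p" "y = Fract c d" "d \<notin> p"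
      unfolding L E_def by blast
    have "x * y = Fract (c * a) (b * d)"
      using * by (simp add: mult.commute)
    then show ?thesis using mul * Jmul unfolding E_def by blast
  qed
  have Eneg: "- x \<in> E" if x: "x \<in> E" for x
  proof -
    from x obtain a b where *: "x = Fract a b" "a \<in> J" "b \<notin> p" unfolding E_def by blast
    have "- x = Fract (- 1 * a) b" using * by simp
    then show ?thesis using * Jmul unfolding E_def by blast
  qed
  have "ideal E (localization_at p)"
  proof (rule idealI)
    have "subgroup E (add_monoid (localization_at p))"
    proof (rule L.add.subgroupI)
      show "E \<subseteq> carrier (localization_at p)" unfolding L E_def by blast
      show "E \<noteq> {}" using J0 one unfolding E_def by blast
      show "a_inv (localization_at p) a \<in> E" if "a \<in> E" for a
      proof -
        have "a_inv (localization_at p) a = - a"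
        proof (rule L.minus_equality)
          show "a \<in> carrier (localization_at p)" "- a \<in> carrier (localization_at p)"
            using that Eneg[OF that] unfolding L E_def by blast+
        qed (simp add: L)
        then show ?thesis using Eneg that by simp
      qed
    qed (use Eadd in \<open>simp add: L(3)\<close>)
    then show "subgroup E (add_monoid (localization_at p))" .
    show "x \<otimes>\<^bsub>localization_at p\<^esub> a \<in> E" "a \<otimes>\<^bsub>localization_at p\<^esub> x \<in> E"
      if "a \<in> E" "x \<in> carrier (localization_at p)" for a x
      using Emul[OF that] unfolding L(2) by (simp_all add: mult.commute)
  qed (rule L.ring_axioms)
  moreover have "(\<lambda>f. Fract f 1) ` J \<subseteq> E" using one unfolding E_def by blast
  moreover have "E \<subseteq> H" if H: "ideal H (localization_at p)" "(\<lambda>f. Fract f 1) ` J \<subseteq> H" for H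
  proof
    fix x assume "x \<in> E"
    then obtain a b where *: "x = Fract a b" "a \<in> J" "b \<notin> p" unfolding E_def by blast
    have "Fract a 1 \<in> H" "Fract 1 b \<in> carrier (localization_at p)"
      using H(2) * unfolding L by blast+
    then have "Fract 1 b * Fract a 1 \<in> H"
      using ideal.I_l_closed[OF H(1), of "Fract a 1" "Fract 1 b"] unfolding L(2) by blast
    then show "x \<in> H" using * by simp
  qed
  ultimately have ext: "extension_at p J = E"
    unfolding extension_at_def genideal_def by blast
  have "(\<exists>a b. Fract f 1 = Fract a b \<and> a \<in> J \<and> b \<notin> p) \<longleftrightarrow> (\<exists>b. b \<notin> p \<and> b * f \<in> J)" for f
  proof
    assume "\<exists>a b. Fract f 1 = Fract a b \<and> a \<in> J \<and> b \<notin> p"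
    then obtain a b where *: "Fract f 1 = Fract a b" "a \<in> J" "b \<notin> p" by blast
    then have "b * f = a" using nz[of b] by (simp add: eq_fract mult.commute)
    with * show "\<exists>b. b \<notin> p \<and> b * f \<in> J" by blast
  next
    assume "\<exists>b. b \<notin> p \<and> b * f \<in> J"
    then obtain b where *: "b \<notin> p" "b * f \<in> J" by blast
    then have "Fract f 1 = Fract (b * f) b" using nz[of b] by (simp add: eq_fract mult.commute)
    with * show "\<exists>a b. Fract f 1 = Fract a b \<and> a \<in> J \<and> b \<notin> p" by blast
  qed
  then show ?thesis unfolding ext E_def by auto
qed

section \<open>Monomial ideals and sets of exponents\<close>

abbreviation expo :: "('n::finite \<Rightarrow> nat) \<Rightarrow> ('n \<Rightarrow>\<^sub>0 nat)" where
  "expo \<equiv> Abs_poly_mapping"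

lemma lookup_expo [simp]: "Poly_Mapping.lookup (expo c) = (c :: 'n::finite \<Rightarrow> nat)"
  by (rule lookup_Abs_poly_mapping) simp

text \<open>Two properties in one. For \<open>A = UNIV\<close> this is upward closure, so
  \<open>U\<close> is the exponent set of a monomial ideal. For smaller \<open>A\<close> it says in
  addition that membership is decided on \<open>A\<close>, so the ideal is extended from the
  polynomial ring in the variables of \<open>A\<close>.\<close>

definition upward_on :: "'n set \<Rightarrow> ('n \<Rightarrow>\<^sub>0 nat) set \<Rightarrow> bool" where
  "upward_on A U \<longleftrightarrow> (\<forall>c\<in>U. \<forall>d. (\<forall>i\<in>A. Poly_Mapping.lookup c i \<le> Poly_Mapping.lookup d i) \<longrightarrow> d \<in> U)"

definition mideal :: "('n \<Rightarrow>\<^sub>0 nat) set \<Rightarrow> ('n::{finite,linorder}, 'k::field) mpoly set" where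
  "mideal U = {f. Poly_Mapping.keys f \<subseteq> U}"

definition irr :: "'n set \<Rightarrow> ('n \<Rightarrow> nat) \<Rightarrow> ('n \<Rightarrow>\<^sub>0 nat) set" where
  "irr A u = {c. \<exists>i\<in>A. u i \<le> Poly_Mapping.lookup c i}"

text \<open>The exponents of a power of a monomial ideal. The value \<open>UNIV\<close> at 0 is the
  unit ideal; starting from \<open>{0}\<close> would not give an upward closed set.\<close>

primrec setpow :: "('n \<Rightarrow>\<^sub>0 nat) set \<Rightarrow> nat \<Rightarrow> ('n \<Rightarrow>\<^sub>0 nat) set" where
  "setpow U 0 = UNIV"
| "setpow U (Suc s) = {a + b | a b. a \<in> setpow U s \<and> b \<in> U}"

abbreviation var_ideal :: "'n set \<Rightarrow> ('n::{finite,linorder}, 'k::field) mpoly set" where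
  "var_ideal A \<equiv> mideal (irr A (\<lambda>_. 1))"

lemma upward_onD:
  "upward_on A U \<Longrightarrow> c \<in> U \<Longrightarrow> (\<And>i. i \<in> A \<Longrightarrow> Poly_Mapping.lookup c i \<le> Poly_Mapping.lookup d i) \<Longrightarrow> d \<in> U"
  unfolding upward_on_def by blast

lemma upward_on_mono: "upward_on A U \<Longrightarrow> A \<subseteq> B \<Longrightarrow> upward_on B U"
  unfolding upward_on_def by blast

lemma upward_on_irr: "upward_on A (irr A u)"
  unfolding upward_on_def irr_def by (blast intro: order_trans)

lemma upward_on_Inter: "(\<And>j. j \<in> S \<Longrightarrow> upward_on A (Q j)) \<Longrightarrow> upward_on A (\<Inter>j\<in>S. Q j)"
  unfolding upward_on_def by blast

lemma upward_on_add: "upward_on A U \<Longrightarrow> a \<in> U \<Longrightarrow> a + b \<in> U" "upward_on A U \<Longrightarrow> a \<in> U \<Longrightarrow> b + a \<in> U"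
  by (erule (1) upward_onD, simp add: lookup_add)+

lemma upward_on_setpow:
  fixes U :: "('n \<Rightarrow>\<^sub>0 nat) set"
  assumes "upward_on A U"
  shows "upward_on A (setpow U s)"
proof (induction s)
  case 0
  then show ?case by (simp add: upward_on_def)
next
  case (Suc s)
  show ?case unfolding upward_on_def
  proof (intro ballI allI impI)
    fix c d :: "'n \<Rightarrow>\<^sub>0 nat"
    assume c: "c \<in> setpow U (Suc s)" and
      le: "\<forall>i\<in>A. Poly_Mapping.lookup c i \<le> Poly_Mapping.lookup d i"
    from c obtain a b where ab: "c = a + b" "a \<in> setpow U s" "b \<in> U" by auto
    \<comment> \<open>The excess of \<open>d\<close> over \<open>c\<close> is given to the second
      summand. On \<open>A\<close> the set inclusion \<open>a \<le> d\<close> makes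
      \<open>d - (d - a)\<close> equal to \<open>a\<close>; elsewhere truncation may make it
      smaller, which is harmless because membership is decided on \<open>A\<close>.\<close>
    have "d - a \<in> U"
      by (rule upward_onD[OF assms ab(3)]) (use le ab(1) in \<open>fastforce simp: lookup_minus lookup_add\<close>)
    moreover have "d - (d - a) \<in> setpow U s"
      by (rule upward_onD[OF Suc ab(2)]) (use le ab(1) in \<open>fastforce simp: lookup_minus lookup_add\<close>)
    moreover have "d = (d - (d - a)) + (d - a)"
      by (rule poly_mapping_eqI) (simp add: lookup_minus lookup_add)
    ultimately show "d \<in> setpow U (Suc s)" by auto
  qed
qed

lemma keys_xmon [simp]: "Poly_Mapping.keys (xmon c) = {c}"
  by (simp add: xmon_def)

lemma xmon_mem_mideal [simp]: "xmon c \<in> mideal U \<longleftrightarrow> c \<in> U"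
  by (simp add: mideal_def)

lemma mideal_eq_iff: "(mideal U :: ('n::{finite,linorder}, 'k::field) mpoly set) = mideal V \<longleftrightarrow> U = V"
proof
  assume "(mideal U :: ('n, 'k) mpoly set) = mideal V"
  then have "(xmon c :: ('n, 'k) mpoly) \<in> mideal U \<longleftrightarrow> (xmon c :: ('n, 'k) mpoly) \<in> mideal V" for c
    by simp
  then show "U = V" by auto
qed simp

lemma mideal_Inter: "mideal (\<Inter>j\<in>S. Q j) = (\<Inter>j\<in>S. mideal (Q j))"
  unfolding mideal_def by blast

lemma xmon_mult: "xmon a * xmon b = xmon (a + b)"
  by (simp add: xmon_def mult_single)

lemma ideal_mideal:
  assumes "upward_on A U"
  shows "ideal (mideal U :: ('n::{finite,linorder}, 'k::field) mpoly set) type_ring"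
  unfolding ideal_type_ring_iff
proof (intro conjI ballI allI)
  fix f g x :: "('n, 'k) mpoly"
  assume f: "f \<in> mideal U"
  show "x * f \<in> mideal U"
    using keys_mult[of x f] upward_on_add(2)[OF assms] f unfolding mideal_def by blast
  assume "g \<in> mideal U"
  then show "f + g \<in> mideal U"
    using keys_add[of f g] f unfolding mideal_def by blast
qed (simp add: mideal_def)

lemma poly_mapping_expand:
  "f = (\<Sum>c\<in>Poly_Mapping.keys f. Poly_Mapping.single c (Poly_Mapping.lookup f c))"
  by (rule poly_mapping_eqI)
    (simp add: lookup_sum lookup_single when_def in_keys_iff)

lemma mideal_subsetI:
  fixes H :: "('n::{finite,linorder}, 'k::field) mpoly set"
  assumes H: "ideal H type_ring" and sub: "\<And>c. c \<in> U \<Longrightarrow> xmon c \<in> H"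
  shows "mideal U \<subseteq> H"
proof
  fix f :: "('n, 'k) mpoly"
  assume f: "f \<in> mideal U"
  have "Poly_Mapping.single c (Poly_Mapping.lookup f c) \<in> H" if "c \<in> Poly_Mapping.keys f" for c
  proof -
    have "Poly_Mapping.single 0 (Poly_Mapping.lookup f c) * xmon c \<in> H"
      using H sub[of c] f that unfolding ideal_type_ring_iff mideal_def by blast
    then show ?thesis by (simp add: xmon_def mult_single)
  qed
  then show "f \<in> H"
    by (subst poly_mapping_expand) (rule ideal_sum_mem[OF H])
qed

definition up_closure :: "('n \<Rightarrow>\<^sub>0 nat) set \<Rightarrow> ('n \<Rightarrow>\<^sub>0 nat) set" where
  "up_closure M = {c. \<exists>a\<in>M. \<forall>i. Poly_Mapping.lookup a i \<le> Poly_Mapping.lookup c i}"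

lemma upward_up_closure: "upward_on UNIV (up_closure M)"
  unfolding upward_on_def up_closure_def by (auto intro: order_trans)

lemma monomial_ideal_gen_eq:
  "(monomial_ideal_gen M :: ('n::{finite,linorder}, 'k::field) mpoly set) = mideal (up_closure M)"
proof
  show "(monomial_ideal_gen M :: ('n, 'k) mpoly set) \<subseteq> mideal (up_closure M)"
    unfolding monomial_ideal_gen_def genideal_def
    using ideal_mideal[OF upward_up_closure[of M]] by (force simp: up_closure_def)
  have "mideal (up_closure M) \<subseteq> H" if H: "ideal H type_ring" "xmon ` M \<subseteq> H"
    for H :: "('n, 'k) mpoly set"
  proof (rule mideal_subsetI[OF H(1)])
    fix c :: "'n \<Rightarrow>\<^sub>0 nat" assume "c \<in> up_closure M"
    then obtain a where a: "a \<in> M" "\<And>i. Poly_Mapping.lookup a i \<le> Poly_Mapping.lookup c i"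
      unfolding up_closure_def by blast
    have "c = (c - a) + a"
      by (rule poly_mapping_eqI) (simp add: lookup_minus lookup_add a(2))
    then have "xmon c = xmon (c - a) * (xmon a :: ('n, 'k) mpoly)"
      by (simp add: xmon_mult)
    then show "xmon c \<in> H"
      using H a(1) unfolding ideal_type_ring_iff by auto
  qed
  then show "mideal (up_closure M) \<subseteq> (monomial_ideal_gen M :: ('n, 'k) mpoly set)"
    unfolding monomial_ideal_gen_def genideal_def by auto
qed

lemma up_closure_upward: "upward_on UNIV U \<Longrightarrow> up_closure U = U"
  unfolding up_closure_def upward_on_def by auto

lemma monomial_ideal_iff:
  "monomial_ideal I \<longleftrightarrow> (\<exists>U. upward_on UNIV U \<and> I = mideal U)"
  unfolding monomial_ideal_def monomial_ideal_gen_eq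
  using upward_up_closure up_closure_upward by metis

lemma irreducible_monomial_ideal_eq: "irreducible_monomial_ideal A u = mideal (irr A u)"
proof -
  have "up_closure ((\<lambda>i. Poly_Mapping.single i (u i)) ` A) = irr A u"
    unfolding up_closure_def irr_def by (auto simp: lookup_single when_def)
  then show ?thesis
    unfolding irreducible_monomial_ideal_def monomial_ideal_gen_eq by simp
qed

lemma ideal_power_mideal:
  fixes U :: "('n::{finite,linorder} \<Rightarrow>\<^sub>0 nat) set"
  assumes U: "upward_on UNIV U"
  shows "ideal_power (mideal U :: ('n, 'k::field) mpoly set) s = mideal (setpow U s)"
proof (induction s)
  case 0
  then show ?case by (simp add: ideal_power_0 mideal_def)
next
  case (Suc s)
  let ?P = "mideal (setpow U s) :: ('n, 'k) mpoly set" and ?U = "mideal U :: ('n, 'k) mpoly set"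
  have "f \<in> mideal (setpow U (Suc s))" if "f \<in> ideal_prod type_ring ?P ?U" for f
    using that
  proof (induction rule: ideal_prod.induct)
    case (prod i j)
    then show ?case using keys_mult[of i j] unfolding mideal_def by force
  next
    case (sum s1 s2)
    then show ?case using keys_add[of s1 s2] unfolding mideal_def by force
  qed
  moreover have "mideal (setpow U (Suc s)) \<subseteq> ideal_prod type_ring ?P ?U"
  proof (rule mideal_subsetI)
    show "ideal (ideal_prod type_ring ?P ?U) type_ring"
      using ideal_mideal[OF U] ideal_mideal[OF upward_on_setpow[OF U]]
      by (intro ring.ideal_prod_is_ideal ring_from_type_algebra)
    fix c assume "c \<in> setpow U (Suc s)"
    then obtain a b where "c = a + b" "a \<in> setpow U s" "b \<in> U" by auto
    then show "xmon c \<in> ideal_prod type_ring ?P ?U"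
      using ideal_prod.prod[of "xmon a" ?P "xmon b" ?U type_ring] by (simp add: xmon_mult)
  qed
  ultimately show ?case unfolding ideal_power_Suc Suc by blast
qed

section \<open>Associated primes and symbolic powers\<close>

lemma lookup_eq_0: "Poly_Mapping.keys f \<subseteq> U \<Longrightarrow> c \<notin> U \<Longrightarrow> Poly_Mapping.lookup f c = 0"
  by (meson not_in_keys_iff_lookup_eq_zero subsetD)

text \<open>Grade by the degree in the variables of \<open>A\<close>. The product of the degree 0 part of \<open>g\<close> with
  the lowest part of \<open>f\<close> outside \<open>Q\<close> is nonzero, and nothing else reaches its exponents.\<close>

lemma mideal_primary:
  fixes f g :: "('n::{finite,linorder}, 'k::field) mpoly"
  assumes Q: "upward_on A Q" and g: "g \<notin> var_ideal A" and gf: "g * f \<in> mideal Q"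
  shows "f \<in> mideal Q"
proof (rule ccontr)
  assume f: "f \<notin> mideal Q"
  define dg where "dg c = (\<Sum>i\<in>A. Poly_Mapping.lookup c i)" for c :: "'n \<Rightarrow>\<^sub>0 nat"
  have dg_add: "dg (a + b) = dg a + dg b" for a b
    by (simp add: dg_def lookup_add sum.distrib)
  define restr where "restr V h = Poly_Mapping.mapp (\<lambda>c x. if c \<in> V then x else 0) h"
    for V and h :: "('n, 'k) mpoly"
  have lookup_restr: "Poly_Mapping.lookup (restr V h) c = (if c \<in> V then Poly_Mapping.lookup h c else 0)"
    for V h c
    by (auto simp: restr_def lookup_mapp when_def in_keys_iff)
  have keys_restr: "Poly_Mapping.keys (restr V h) = Poly_Mapping.keys h \<inter> V" for V h
    by (auto simp: in_keys_iff lookup_restr split: if_splits)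
  have split: "h = restr V h + restr (- V) h" for V h
    by (rule poly_mapping_eqI) (simp add: lookup_add lookup_restr)
  define d where "d = (LEAST d. \<exists>c\<in>Poly_Mapping.keys f - Q. dg c = d)"
  have ex: "\<exists>d. \<exists>c\<in>Poly_Mapping.keys f - Q. dg c = d"
    using f unfolding mideal_def by blast
  have dmin: "d \<le> dg c" if "c \<in> Poly_Mapping.keys f" "c \<notin> Q" for c
    unfolding d_def by (rule Least_le) (use that in blast)
  obtain c0 where c0: "c0 \<in> Poly_Mapping.keys f" "c0 \<notin> Q" "dg c0 = d"
    using LeastI_ex[OF ex] unfolding d_def by blast
  define f1 where "f1 = restr Q f"
  define f0 where "f0 = restr (- Q) f"
  define t where "t = restr {c. dg c = d} f0"
  define t' where "t' = restr (- {c. dg c = d}) f0"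
  define g0 where "g0 = restr {c. dg c = 0} g"
  define g1 where "g1 = restr (- {c. dg c = 0}) g"
  have eq: "g * f = g0 * t + (g1 * t + g * t' + g * f1)"
  proof -
    have "f = f1 + (t + t')" "g = g0 + g1"
      unfolding f1_def f0_def t_def t'_def g0_def g1_def using split by metis+
    then have "g * f = g * f1 + g * t + g * t'" "g * t = g0 * t + g1 * t"
      by (metis distrib_left add.assoc, metis distrib_right)
    then show ?thesis by (simp add: add_ac)
  qed
  have "c0 \<in> Poly_Mapping.keys t"
    using c0 by (auto simp: t_def f0_def keys_restr)
  moreover obtain c1 where "c1 \<in> Poly_Mapping.keys g" "c1 \<notin> irr A (\<lambda>_. 1)"
    using g unfolding mideal_def by blast
  then have "c1 \<in> Poly_Mapping.keys g0"
    by (auto simp: g0_def keys_restr dg_def irr_def Suc_le_eq)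
  ultimately have "g0 * t \<noteq> 0" by auto
  then obtain k where k: "k \<in> Poly_Mapping.keys (g0 * t)"
    by (metis equals0I in_keys_iff lookup_zero poly_mapping_eqI)
  then obtain a b where ab: "k = a + b" "a \<in> Poly_Mapping.keys g0" "b \<in> Poly_Mapping.keys t"
    using keys_mult[of g0 t] by blast
  have a: "dg a = 0" and b: "dg b = d" "b \<notin> Q"
    using ab by (auto simp: g0_def t_def f0_def keys_restr)
  have kd: "dg k = d" using ab a b by (simp add: dg_add)
  \<comment> \<open>\<open>a\<close> vanishes on \<open>A\<close>, so \<open>k\<close> and
    \<open>b\<close> agree there, and \<open>upward_on A\<close> decides membership in
    \<open>Q\<close> by these coordinates.\<close>
  have kQ: "k \<notin> Q"
  proof
    assume "k \<in> Q"
    then have "b \<in> Q"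
      by (rule upward_onD[OF Q]) (use a ab(1) in \<open>simp add: dg_def lookup_add\<close>)
    with b show False by simp
  qed
  have "Poly_Mapping.lookup (g1 * t) k = 0"
  proof (rule lookup_eq_0[of _ "{c. dg c > d}"])
    show "Poly_Mapping.keys (g1 * t) \<subseteq> {c. dg c > d}"
      using keys_mult[of g1 t] by (fastforce simp: g1_def t_def keys_restr dg_add)
  qed (simp add: kd)
  moreover have "Poly_Mapping.lookup (g * t') k = 0"
  proof (rule lookup_eq_0[of _ "{c. dg c > d}"])
    have "dg c > d" if "c \<in> Poly_Mapping.keys t'" for c
      using that dmin[of c] by (auto simp: t'_def f0_def keys_restr)
    then show "Poly_Mapping.keys (g * t') \<subseteq> {c. dg c > d}"
      using keys_mult[of g t'] by (fastforce simp: dg_add)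
  qed (simp add: kd)
  moreover have "Poly_Mapping.lookup (g * f1) k = 0"
  proof (rule lookup_eq_0[of _ Q])
    show "Poly_Mapping.keys (g * f1) \<subseteq> Q"
      using keys_mult[of g f1] upward_on_add(2)[OF Q] unfolding f1_def keys_restr by blast
  qed (rule kQ)
  ultimately have "Poly_Mapping.lookup (g * f) k \<noteq> 0"
    using k unfolding eq by (simp add: lookup_add in_keys_iff)
  then show False
    using gf kQ unfolding mideal_def by (auto simp: in_keys_iff)
qed

section \<open>Primes generated by variables, radicals and heights\<close>

lemma upward_on_UNIV: "upward_on A U \<Longrightarrow> upward_on UNIV U"
  by (rule upward_on_mono[OF _ subset_UNIV])

lemma primeideal_var_ideal: "primeideal (var_ideal A :: ('n::{finite,linorder}, 'k::field) mpoly set) type_ring"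
  unfolding primeideal_type_ring_iff
proof (intro conjI allI impI)
  show "ideal (var_ideal A :: ('n, 'k) mpoly set) type_ring"
    by (rule ideal_mideal[OF upward_on_irr])
  have "(1 :: ('n, 'k) mpoly) \<notin> var_ideal A"
    by (simp add: mideal_def irr_def)
  then show "(var_ideal A :: ('n, 'k) mpoly set) \<noteq> UNIV" by blast
  show "a \<in> var_ideal A \<or> b \<in> var_ideal A" if "a * b \<in> var_ideal A" for a b :: "('n, 'k) mpoly"
    using mideal_primary[OF upward_on_irr _ that] by blast
qed

text \<open>Pigeonhole: every monomial of \<open>g ^ m\<close> has degree at least \<open>m\<close>
  in the variables of \<open>A\<close>, and a degree beyond the sum of the \<open>u i\<close> forces
  some exponent up to \<open>u i\<close>.\<close>

lemma var_ideal_power_mem: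
  fixes g :: "('n::{finite,linorder}, 'k::field) mpoly"
  assumes g: "g \<in> var_ideal A"
  obtains m where "g ^ m \<in> mideal (irr A u)"
proof
  let ?m = "Suc (\<Sum>i\<in>A. u i)"
  have "Poly_Mapping.keys (g ^ m) \<subseteq> {c. m \<le> (\<Sum>i\<in>A. Poly_Mapping.lookup c i)}" for m
  proof (induction m)
    case (Suc m)
    have "1 \<le> (\<Sum>i\<in>A. Poly_Mapping.lookup c i)" if c: "c \<in> Poly_Mapping.keys g" for c
    proof -
      obtain i where "i \<in> A" "1 \<le> Poly_Mapping.lookup c i"
        using g c unfolding mideal_def irr_def by blast
      then show ?thesis
        using member_le_sum[of i A "Poly_Mapping.lookup c"] by simp
    qed
    then show ?case
      using keys_mult[of g "g ^ m"] Suc by (fastforce simp: lookup_add sum.distrib)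
  qed simp
  moreover have "c \<in> irr A u" if "?m \<le> (\<Sum>i\<in>A. Poly_Mapping.lookup c i)" for c
  proof (rule ccontr)
    assume "c \<notin> irr A u"
    then have "(\<Sum>i\<in>A. Poly_Mapping.lookup c i) \<le> (\<Sum>i\<in>A. u i)"
      by (intro sum_mono) (auto simp: irr_def not_le intro: less_imp_le)
    with that show False by simp
  qed
  ultimately show "g ^ ?m \<in> mideal (irr A u)"
    unfolding mideal_def by blast
qed

lemma irr_antimono: "(\<And>i. i \<in> A \<Longrightarrow> v i \<le> u i) \<Longrightarrow> irr A u \<subseteq> irr A v"
  unfolding irr_def by (blast intro: le_trans)

lemma mideal_mono: "U \<subseteq> V \<Longrightarrow> mideal U \<subseteq> mideal V"
  unfolding mideal_def by blast

lemma radical_ideal_irr: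
  assumes "\<And>i. i \<in> A \<Longrightarrow> 1 \<le> u i"
  shows "radical_ideal type_ring (mideal (irr A u) :: ('n::{finite,linorder}, 'k::field) mpoly set) = var_ideal A"
proof -
  have "f \<in> var_ideal A" if "f ^ m \<in> mideal (irr A u)" for f :: "('n, 'k) mpoly" and m
    using subsetD[OF mideal_mono[OF irr_antimono[OF assms]] that]
    by (rule prime_power_mem[OF primeideal_var_ideal])
  moreover have "\<exists>m. f ^ m \<in> mideal (irr A u)" if "f \<in> var_ideal A" for f :: "('n, 'k) mpoly"
    using var_ideal_power_mem[OF that] by metis
  ultimately show ?thesis
    unfolding radical_ideal_def type_ring_simps nat_pow_type_ring by blast
qed

lemma var_ideal_subset_iff:
  "(var_ideal A :: ('n::{finite,linorder}, 'k::field) mpoly set) \<subseteq> var_ideal B \<longleftrightarrow> A \<subseteq> B"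
proof
  assume sub: "(var_ideal A :: ('n, 'k) mpoly set) \<subseteq> var_ideal B"
  show "A \<subseteq> B"
  proof
    fix i assume "i \<in> A"
    then have "(xmon (Poly_Mapping.single i 1) :: ('n, 'k) mpoly) \<in> var_ideal A"
      by (auto simp: irr_def intro!: bexI[of _ i])
    with sub have "(xmon (Poly_Mapping.single i 1) :: ('n, 'k) mpoly) \<in> var_ideal B" by blast
    then show "i \<in> B" by (auto simp: irr_def lookup_single when_def split: if_splits)
  qed
qed (auto intro!: mideal_mono simp: irr_def)

text \<open>Adding the variables of \<open>A\<close> one at a time gives a chain of primes of length
  \<open>card A\<close>. This turns height 2 into the bound of two variables per component.\<close>

lemma card_le_height:
  "enat (card A) \<le> height type_ring (var_ideal A :: ('n::{finite,linorder}, 'k::field) mpoly set)"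
proof -
  obtain xs where xs: "distinct xs" "set xs = A"
    using finite_distinct_list[of A] by auto
  let ?P = "\<lambda>k. var_ideal (set (take k xs)) :: ('n, 'k) mpoly set"
  have "?P k \<subset> ?P (Suc k)" if k: "k < card A" for k
  proof -
    have k: "k < length xs" using k xs distinct_card by fastforce
    then have "xs ! k \<notin> set (take k xs)"
      using xs(1) by (auto simp: in_set_conv_nth nth_eq_iff_index_eq)
    moreover have "set (take (Suc k) xs) = insert (xs ! k) (set (take k xs))"
      using k by (simp add: take_Suc_conv_app_nth)
    ultimately show ?thesis
      unfolding less_le_not_le[of "?P k"] var_ideal_subset_iff by auto
  qed
  then have "\<forall>i<card A. ?P i \<subset> ?P (Suc i)" by blast
  moreover have "\<forall>i\<le>card A. primeideal (?P i) type_ring"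
    using primeideal_var_ideal by blast
  moreover have "?P (card A) = var_ideal A"
    using distinct_card[OF xs(1)] xs(2) by simp
  ultimately have "enat (card A) \<in> {enat k | k. \<exists>P. P k = (var_ideal A :: ('n, 'k) mpoly set) \<and>
      (\<forall>i\<le>k. primeideal (P i) type_ring) \<and> (\<forall>i<k. P i \<subset> P (Suc i))}"
    by (intro CollectI exI[of _ "card A"] exI[of _ ?P] conjI refl)
  then show ?thesis
    unfolding height_def by (rule Sup_upper)
qed

text \<open>Components containing \<open>f\<close> do not constrain the colon ideal
  \<open>p\<close>. For each of the others (the set \<open>T\<close>), primariness gives
  \<open>p \<subseteq> var_ideal (A j)\<close>. If all these inclusions were strict, each such
  component would contain a power \<open>h j\<close> outside \<open>p\<close>; the product of the
  \<open>h j\<close> multiplies \<open>f\<close> into every component, hence lies in the prime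
  \<open>p\<close>, a contradiction.\<close>

lemma prime_colon_eq_var_ideal:
  fixes A :: "'j \<Rightarrow> 'n::{finite,linorder} set"
  assumes fin: "finite S" and u: "\<And>j i. j \<in> S \<Longrightarrow> i \<in> A j \<Longrightarrow> 1 \<le> u j i"
    and p: "p \<in> associated_primes type_ring (mideal (\<Inter>j\<in>S. irr (A j) (u j)) :: ('n, 'k::field) mpoly set)"
  shows "\<exists>j\<in>S. p = var_ideal (A j)"
proof (rule ccontr)
  assume no: "\<not> (\<exists>j\<in>S. p = var_ideal (A j))"
  let ?Q = "\<lambda>j. mideal (irr (A j) (u j)) :: ('n, 'k) mpoly set"
  from p obtain f where prime: "primeideal p type_ring" and
    pf: "p = {g. g * f \<in> mideal (\<Inter>j\<in>S. irr (A j) (u j))}"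
    unfolding associated_primes_def by auto
  define T where "T = {j \<in> S. f \<notin> ?Q j}"
  have "\<exists>h. h \<in> ?Q j \<and> h \<notin> p" if j: "j \<in> T" for j
  proof -
    have "p \<subseteq> var_ideal (A j)"
      using j mideal_primary[OF upward_on_irr, of _ "A j" f] unfolding pf T_def mideal_Inter by blast
    moreover have "p \<noteq> var_ideal (A j)" using no j unfolding T_def by blast
    ultimately obtain g where g: "g \<in> var_ideal (A j)" "g \<notin> p" by blast
    obtain m where "g ^ m \<in> ?Q j" using var_ideal_power_mem[OF g(1)] .
    moreover have "g ^ m \<notin> p" using prime_power_mem[OF prime] g(2) by blast
    ultimately show ?thesis by blast
  qed
  then obtain h where h: "\<And>j. j \<in> T \<Longrightarrow> h j \<in> ?Q j" "\<And>j. j \<in> T \<Longrightarrow> h j \<notin> p" by metis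
  have mul: "x * y \<in> ?Q j" if "y \<in> ?Q j" for x y j
    using ideal_mideal[OF upward_on_irr[of "A j" "u j"]] that unfolding ideal_type_ring_iff by blast
  have "prod h T * f \<in> ?Q j" if j: "j \<in> S" for j
  proof (cases "j \<in> T")
    case True
    have "prod h T = h j * prod h (T - {j})"
      using True fin by (intro prod.remove) (simp_all add: T_def)
    then have "prod h T * f = (prod h (T - {j}) * f) * h j" by (simp add: mult_ac)
    then show ?thesis using mul h(1)[OF True] by metis
  next
    case False
    then show ?thesis using mul j unfolding T_def by blast
  qed
  then have "prod h T \<in> p" unfolding pf mideal_Inter by blast
  then show False using prime_prod_notin[OF prime, of T h] h(2) by blast
qed

text \<open>The exponent \<open>c\<close> certifies that component \<open>j\<close> cannot be
  omitted. This form serves both the given irredundant decomposition and an arbitrary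
  antichain.\<close>

lemma var_ideal_associated_prime:
  fixes A :: "'j \<Rightarrow> 'n::{finite,linorder} set"
  assumes j: "j \<in> S" and u: "\<And>i. i \<in> A j \<Longrightarrow> 1 \<le> u j i"
    and c: "c \<in> (\<Inter>k\<in>S - {j}. irr (A k) (u k))" "c \<notin> irr (A j) (u j)"
  shows "var_ideal (A j) \<in> associated_primes type_ring
           (mideal (\<Inter>j\<in>S. irr (A j) (u j)) :: ('n, 'k::field) mpoly set)"
proof -
  let ?Q = "\<lambda>j. mideal (irr (A j) (u j)) :: ('n, 'k) mpoly set"
  \<comment> \<open>the largest exponent on \<open>A j\<close> outside \<open>irr (A j) (u j)\<close>, so that the colon ideal is prime\<close>
  define c' where "c' = expo (\<lambda>i. if i \<in> A j then u j i - 1 else Poly_Mapping.lookup c i)"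
  have c'j: "c' \<notin> irr (A j) (u j)"
    using u by (fastforce simp: c'_def irr_def)
  have le: "Poly_Mapping.lookup c i \<le> Poly_Mapping.lookup c' i" for i
    using c(2) by (fastforce simp: c'_def irr_def)
  have c'k: "c' \<in> irr (A k) (u k)" if "k \<in> S" "k \<noteq> j" for k
    using upward_onD[OF upward_on_irr[of "A k" "u k"], of c c'] le c(1) that by blast
  have "g * xmon c' \<in> mideal (\<Inter>j\<in>S. irr (A j) (u j)) \<longleftrightarrow> g \<in> var_ideal (A j)" for g :: "('n, 'k) mpoly"
  proof
    assume "g * xmon c' \<in> mideal (\<Inter>j\<in>S. irr (A j) (u j))"
    then have "g * xmon c' \<in> ?Q j" using j unfolding mideal_Inter by blast
    then show "g \<in> var_ideal (A j)"
      using mideal_primary[OF upward_on_irr, of g "A j" "xmon c'"] c'j by auto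
  next
    assume g: "g \<in> var_ideal (A j)"
    have "a + c' \<in> irr (A k) (u k)" if a: "a \<in> Poly_Mapping.keys g" and k: "k \<in> S" for a k
    proof (cases "k = j")
      case True
      obtain i where i: "i \<in> A j" "1 \<le> Poly_Mapping.lookup a i"
        using a g unfolding mideal_def irr_def by blast
      then have "u j i \<le> Poly_Mapping.lookup (a + c') i"
        by (simp add: lookup_add c'_def)
      then show ?thesis using i(1) True unfolding irr_def by blast
    next
      case False
      then show ?thesis using upward_on_add(2)[OF upward_on_irr] c'k k by blast
    qed
    then show "g * xmon c' \<in> mideal (\<Inter>j\<in>S. irr (A j) (u j))"
      using keys_mult[of g "xmon c'"] unfolding mideal_def by fastforce
  qed
  then have "var_ideal (A j) = {g. g * xmon c' \<in> (mideal (\<Inter>j\<in>S. irr (A j) (u j)) :: ('n, 'k) mpoly set)}"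
    by blast
  then show ?thesis
    using primeideal_var_ideal[of "A j"] unfolding associated_primes_def type_ring_simps by blast
qed

lemma associated_primes_antichain:
  fixes A :: "'j \<Rightarrow> 'n::{finite,linorder} set"
  assumes fin: "finite S" and u: "\<And>j i. j \<in> S \<Longrightarrow> i \<in> A j \<Longrightarrow> 1 \<le> u j i"
    and anti: "\<And>j k. j \<in> S \<Longrightarrow> k \<in> S \<Longrightarrow> A j \<subseteq> A k \<Longrightarrow> j = k"
  shows "associated_primes type_ring (mideal (\<Inter>j\<in>S. irr (A j) (u j)) :: ('n, 'k::field) mpoly set)
           = (\<lambda>j. var_ideal (A j)) ` S"
proof (intro equalityI subsetI)
  fix p assume p: "p \<in> associated_primes type_ring (mideal (\<Inter>j\<in>S. irr (A j) (u j)) :: ('n, 'k) mpoly set)"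
  have "\<exists>j\<in>S. p = var_ideal (A j)"
    by (rule prime_colon_eq_var_ideal[OF fin _ p]) (rule u)
  then show "p \<in> (\<lambda>j. var_ideal (A j)) ` S" by blast
next
  fix p :: "('n, 'k) mpoly set" assume "p \<in> (\<lambda>j. var_ideal (A j)) ` S"
  then obtain j where j: "j \<in> S" "p = var_ideal (A j)" by blast
  \<comment> \<open>Irredundancy is automatic for an antichain: zero on \<open>A j\<close> keeps
    \<open>c\<close> out of component \<open>j\<close>, while every other \<open>A k\<close> has a
    variable outside \<open>A j\<close>, where \<open>c\<close> reaches all weights.\<close>
  define c where "c = expo (\<lambda>i. if i \<in> A j then 0 else (\<Sum>k\<in>S. u k i))"
  have "\<forall>i\<in>A j. u j i \<noteq> 0"
    using u[OF j(1)] by (metis not_one_le_zero)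
  then have "c \<notin> irr (A j) (u j)"
    by (auto simp: c_def irr_def)
  moreover have "c \<in> irr (A k) (u k)" if k: "k \<in> S - {j}" for k
  proof -
    obtain i where i: "i \<in> A k" "i \<notin> A j" using anti[of k j] k j(1) by blast
    have "u k i \<le> (\<Sum>k\<in>S. u k i)"
      by (rule member_le_sum) (use fin k in auto)
    then show ?thesis using i(2) unfolding irr_def c_def by (intro CollectI bexI[OF _ i(1)]) simp
  qed
  ultimately show "p \<in> associated_primes type_ring (mideal (\<Inter>j\<in>S. irr (A j) (u j)) :: ('n, 'k) mpoly set)"
    unfolding j(2) by (intro var_ideal_associated_prime[where c = c] j(1) u INT_I)
qed

section \<open>Symbolic powers as intersections of powers of the components\<close>

lemma setpow_mono: "U \<subseteq> V \<Longrightarrow> setpow U s \<subseteq> setpow V s"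
  by (induction s) (simp, simp, blast)

lemma symbolic_power_antichain:
  fixes A :: "'j \<Rightarrow> 'n::{finite,linorder} set"
  assumes fin: "finite S" and u: "\<And>j i. j \<in> S \<Longrightarrow> i \<in> A j \<Longrightarrow> 1 \<le> u j i"
    and anti: "\<And>j k. j \<in> S \<Longrightarrow> k \<in> S \<Longrightarrow> A j \<subseteq> A k \<Longrightarrow> j = k"
  shows "symbolic_power (mideal (\<Inter>j\<in>S. irr (A j) (u j)) :: ('n, 'k::field) mpoly set) s
           = mideal (\<Inter>j\<in>S. setpow (irr (A j) (u j)) s)"
proof -
  define U where "U = (\<Inter>j\<in>S. irr (A j) (u j))"
  have U: "upward_on UNIV U"
    unfolding U_def by (intro upward_on_Inter upward_on_UNIV[OF upward_on_irr])
  have "{f. \<exists>b. b \<notin> var_ideal (A j) \<and> b * f \<in> mideal (setpow U s)}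
          = (mideal (setpow (irr (A j) (u j)) s) :: ('n, 'k) mpoly set)" if j: "j \<in> S" for j
  proof (intro equalityI subsetI, clarify)
    fix f b :: "('n, 'k) mpoly"
    assume b: "b \<notin> var_ideal (A j)" "b * f \<in> mideal (setpow U s)"
    have "setpow U s \<subseteq> setpow (irr (A j) (u j)) s"
      by (rule setpow_mono) (use j in \<open>auto simp: U_def\<close>)
    then have "b * f \<in> mideal (setpow (irr (A j) (u j)) s)"
      using b(2) mideal_mono by blast
    then show "f \<in> mideal (setpow (irr (A j) (u j)) s)"
      using mideal_primary[OF upward_on_setpow[OF upward_on_irr] b(1)] by blast
  next
    fix f :: "('n, 'k) mpoly"
    assume f: "f \<in> mideal (setpow (irr (A j) (u j)) s)"
    \<comment> \<open>The \<open>m\<close>-th power of a monomial in the variables outside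
      \<open>A j\<close>, so a unit in the localization. One factor carries component
      \<open>j\<close> into all the others; \<open>m\<close> factors do so for each of the
      \<open>m\<close> summands of an element of \<open>setpow\<close>.\<close>
    define h where "h m = expo (\<lambda>i. if i \<in> A j then 0 else m * (\<Sum>k\<in>S. u k i))" for m
    have h1: "c + h 1 \<in> U" if c: "c \<in> irr (A j) (u j)" for c
      unfolding U_def
    proof
      fix k assume k: "k \<in> S"
      show "c + h 1 \<in> irr (A k) (u k)"
      proof (cases "k = j")
        case True
        then show ?thesis using upward_on_add(1)[OF upward_on_irr] c by blast
      next
        case False
        then obtain i where i: "i \<in> A k" "i \<notin> A j" using anti[of k j] k j by blast
        have "u k i \<le> (\<Sum>k\<in>S. u k i)"
          by (rule member_le_sum) (use fin k in auto)
        then show ?thesis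
          using i(2) unfolding irr_def h_def
          by (intro CollectI bexI[OF _ i(1)]) (simp add: lookup_add trans_le_add2)
      qed
    qed
    have hS: "h (Suc m) = h m + h 1" for m
      by (rule poly_mapping_eqI) (simp add: h_def lookup_add)
    have hs: "c + h m \<in> setpow U m" if "c \<in> setpow (irr (A j) (u j)) m" for c m
      using that
    proof (induction m arbitrary: c)
      case (Suc m)
      then obtain a b where ab: "c = a + b" "a \<in> setpow (irr (A j) (u j)) m" "b \<in> irr (A j) (u j)"
        by auto
      have "c + h (Suc m) = (a + h m) + (b + h 1)"
        unfolding hS ab(1) by (simp add: add_ac)
      then show ?case using Suc.IH[OF ab(2)] h1[OF ab(3)] by auto
    qed simp
    have "xmon (h s) * f \<in> mideal (setpow U s)"
      using keys_mult[of "xmon (h s)" f] f hs[of _ s] unfolding mideal_def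
      by (fastforce simp: add.commute)
    moreover have "(xmon (h s) :: ('n, 'k) mpoly) \<notin> var_ideal (A j)"
      by (auto simp: irr_def h_def)
    ultimately show "f \<in> {f. \<exists>b. b \<notin> var_ideal (A j) \<and> b * f \<in> mideal (setpow U s)}" by blast
  qed
  moreover have "associated_primes type_ring (mideal U :: ('n, 'k) mpoly set) = (\<lambda>j. var_ideal (A j)) ` S"
    unfolding U_def by (rule associated_primes_antichain[OF fin u anti])
  moreover have "{f. Fract f 1 \<in> extension_at (var_ideal (A j)) (ideal_power (mideal U) s)} =
      {f :: ('n, 'k) mpoly. \<exists>b. b \<notin> var_ideal (A j) \<and> b * f \<in> mideal (setpow U s)}" for j
    unfolding ideal_power_mideal[OF U]
    by (rule extension_at_contraction[OF primeideal_var_ideal ideal_mideal[OF upward_on_setpow[OF U]]])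
  ultimately show ?thesis
    unfolding symbolic_power_def mideal_Inter[of "\<lambda>j. setpow (irr (A j) (u j)) s"] U_def[symmetric]
    by (simp del: One_nat_def)
qed

lemma simis_ideal_antichain_iff:
  fixes A :: "'j \<Rightarrow> 'n::{finite,linorder} set"
  assumes fin: "finite S" and u: "\<And>j i. j \<in> S \<Longrightarrow> i \<in> A j \<Longrightarrow> 1 \<le> u j i"
    and anti: "\<And>j k. j \<in> S \<Longrightarrow> k \<in> S \<Longrightarrow> A j \<subseteq> A k \<Longrightarrow> j = k"
  shows "simis_ideal (mideal (\<Inter>j\<in>S. irr (A j) (u j)) :: ('n, 'k::field) mpoly set) \<longleftrightarrow>
    (\<forall>s\<ge>1. (\<Inter>j\<in>S. setpow (irr (A j) (u j)) s) = setpow (\<Inter>j\<in>S. irr (A j) (u j)) s)"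
proof -
  have U: "upward_on UNIV (\<Inter>j\<in>S. irr (A j) (u j))"
    by (intro upward_on_Inter upward_on_UNIV[OF upward_on_irr])
  have "monomial_ideal (mideal (\<Inter>j\<in>S. irr (A j) (u j)) :: ('n, 'k) mpoly set)"
    unfolding monomial_ideal_iff using U by (intro exI conjI) (rule U, rule refl)
  moreover have "symbolic_power (mideal (\<Inter>j\<in>S. irr (A j) (u j)) :: ('n, 'k) mpoly set) s
      = mideal (\<Inter>j\<in>S. setpow (irr (A j) (u j)) s)" for s
    by (rule symbolic_power_antichain[OF fin u anti])
  ultimately show ?thesis
    unfolding simis_ideal_def by (simp only: ideal_power_mideal[OF U] mideal_eq_iff simp_thms)
qed

section \<open>Weightings\<close>

text \<open>The adjoint of \<open>weight_exponent\<close>: for positive weights, v a <= d holds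
  exactly if a <= d div v. Hence weighting an ideal means taking the preimage of its exponent set
  under this map.\<close>

definition div_exponent :: "('n::finite \<Rightarrow> nat) \<Rightarrow> ('n \<Rightarrow>\<^sub>0 nat) \<Rightarrow> ('n \<Rightarrow>\<^sub>0 nat)" where
  "div_exponent v d = expo (\<lambda>i. Poly_Mapping.lookup d i div v i)"

lemma lookup_div_exponent [simp]:
  "Poly_Mapping.lookup (div_exponent v d) i = Poly_Mapping.lookup d i div v i"
  by (simp add: div_exponent_def)

lemma lookup_weight_exponent [simp]:
  "Poly_Mapping.lookup (weight_exponent v a) i = v i * Poly_Mapping.lookup a i"
  by (simp add: weight_exponent_def lookup_mapp when_def in_keys_iff)

lemma div_weight_exponent [simp]:
  "standard_linear_weighting v \<Longrightarrow> div_exponent v (weight_exponent v a) = a"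
  by (rule poly_mapping_eqI) (simp add: standard_linear_weighting_def Suc_le_eq)

lemma irr_eq_div_exponent:
  assumes "standard_linear_weighting v"
  shows "irr A v = {d. div_exponent v d \<in> irr A (\<lambda>_. 1)}"
  using assms unfolding irr_def standard_linear_weighting_def
  by (simp add: Suc_le_eq div_greater_zero_iff)

text \<open>Rounding down is superadditive, which gives one inclusion. For the other, a
  decomposition of the quotient is lifted by taking exactly v b as one summand and leaving all
  remainders to the other.\<close>

lemma setpow_div_exponent:
  assumes v: "standard_linear_weighting v" and V: "upward_on UNIV V"
  shows "setpow {d. div_exponent v d \<in> V} s = {d. div_exponent v d \<in> setpow V s}"
proof (induction s)
  case (Suc s)
  have pos: "0 < v i" for i using v by (simp add: standard_linear_weighting_def Suc_le_eq)
  have "div_exponent v (a + b) \<in> setpow V (Suc s)"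
    if "div_exponent v a \<in> setpow V s" "div_exponent v b \<in> V" for a b
  proof -
    have "div_exponent v a + div_exponent v b \<in> setpow V (Suc s)" using that by auto
    then show ?thesis
      by (rule upward_onD[OF upward_on_setpow[OF V]])
        (simp add: lookup_add pos less_eq_div_iff_mult_less_eq distrib_right add_mono)
  qed
  moreover have "\<exists>a b. d = a + b \<and> div_exponent v a \<in> setpow V s \<and> div_exponent v b \<in> V"
    if d: "div_exponent v d \<in> setpow V (Suc s)" for d
  proof -
    obtain a b where ab: "div_exponent v d = a + b" "a \<in> setpow V s" "b \<in> V"
      using d by auto
    have le: "v i * (Poly_Mapping.lookup a i + Poly_Mapping.lookup b i) \<le> Poly_Mapping.lookup d i" for i
      using arg_cong[OF ab(1), of "\<lambda>e. Poly_Mapping.lookup e i"] times_div_less_eq_dividend[of "v i" "Poly_Mapping.lookup d i"]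
      by (simp add: lookup_add)
    have "d = (d - weight_exponent v b) + weight_exponent v b"
    proof (rule poly_mapping_eqI)
      show "Poly_Mapping.lookup d i = Poly_Mapping.lookup (d - weight_exponent v b + weight_exponent v b) i" for i
        using le[of i] by (simp add: lookup_add lookup_minus distrib_left)
    qed
    moreover have "div_exponent v (d - weight_exponent v b) \<in> setpow V s"
    proof (rule upward_onD[OF upward_on_setpow[OF V] ab(2)])
      fix i
      show "Poly_Mapping.lookup a i \<le> Poly_Mapping.lookup (div_exponent v (d - weight_exponent v b)) i"
        using le[of i] pos[of i] by (simp add: less_eq_div_iff_mult_less_eq lookup_minus algebra_simps)
    qed
    moreover have "div_exponent v (weight_exponent v b) \<in> V"
      using ab(3) v by simp
    ultimately show ?thesis by blast
  qed
  ultimately show ?case unfolding setpow.simps(2) Suc by blast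
qed simp

lemma weighted_ideal_mideal:
  assumes v: "standard_linear_weighting v" and V: "upward_on UNIV V"
  shows "weighted_ideal v (mideal V) = mideal {d. div_exponent v d \<in> V}"
proof -
  have pos: "0 < v i" for i using v by (simp add: standard_linear_weighting_def Suc_le_eq)
  have "up_closure {weight_exponent v a | a. a \<in> V} = {d. div_exponent v d \<in> V}"
  proof (intro equalityI subsetI)
    fix d assume "d \<in> up_closure {weight_exponent v a | a. a \<in> V}"
    then obtain a where a: "a \<in> V" "\<And>i. v i * Poly_Mapping.lookup a i \<le> Poly_Mapping.lookup d i"
      unfolding up_closure_def by auto
    have "div_exponent v d \<in> V"
      by (rule upward_onD[OF V a(1)])
        (simp add: less_eq_div_iff_mult_less_eq pos a(2) mult.commute)
    then show "d \<in> {d. div_exponent v d \<in> V}" by simp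
  next
    fix d assume "d \<in> {d. div_exponent v d \<in> V}"
    moreover have "Poly_Mapping.lookup (weight_exponent v (div_exponent v d)) i \<le> Poly_Mapping.lookup d i" for i
      by simp
    ultimately show "d \<in> up_closure {weight_exponent v a | a. a \<in> V}"
      unfolding up_closure_def by blast
  qed
  then show ?thesis
    unfolding weighted_ideal_def monomial_ideal_gen_eq by simp
qed

lemma simis_ideal_weighting_iff:
  fixes A :: "'j \<Rightarrow> 'n::{finite,linorder} set"
  assumes fin: "finite S" and anti: "\<And>j k. j \<in> S \<Longrightarrow> k \<in> S \<Longrightarrow> A j \<subseteq> A k \<Longrightarrow> j = k"
    and v: "standard_linear_weighting v"
  shows "simis_ideal (mideal (\<Inter>j\<in>S. irr (A j) v) :: ('n, 'k::field) mpoly set) \<longleftrightarrow>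
    simis_ideal (mideal (\<Inter>j\<in>S. irr (A j) (\<lambda>_. 1)) :: ('n, 'k) mpoly set)"
proof -
  let ?L = "\<lambda>s. \<Inter>j\<in>S. setpow (irr (A j) (\<lambda>_. 1)) s"
    and ?R = "setpow (\<Inter>j\<in>S. irr (A j) (\<lambda>_. 1))"
  have up: "upward_on UNIV (irr B u)" for B :: "'n set" and u
    by (rule upward_on_UNIV[OF upward_on_irr])
  have "(\<Inter>j\<in>S. irr (A j) v) = {d. div_exponent v d \<in> (\<Inter>j\<in>S. irr (A j) (\<lambda>_. 1))}"
    unfolding irr_eq_div_exponent[OF v] by blast
  then have "setpow (\<Inter>j\<in>S. irr (A j) v) s = {d. div_exponent v d \<in> ?R s}" for s
    by (simp only: setpow_div_exponent[OF v upward_on_Inter[OF up]])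
  moreover have "(\<Inter>j\<in>S. setpow (irr (A j) v) s) = {d. div_exponent v d \<in> ?L s}" for s
    unfolding irr_eq_div_exponent[OF v] setpow_div_exponent[OF v up] by blast
  \<comment> \<open>\<open>div_exponent v\<close> is surjective, with right inverse
    \<open>weight_exponent v\<close>, so preimages determine the sets.\<close>
  moreover have "{d. div_exponent v d \<in> C} = {d. div_exponent v d \<in> D} \<longleftrightarrow> C = D" for C D
  proof
    assume *: "{d. div_exponent v d \<in> C} = {d. div_exponent v d \<in> D}"
    have "c \<in> C \<longleftrightarrow> c \<in> D" for c
      using arg_cong[OF *, of "\<lambda>T. weight_exponent v c \<in> T"] v by simp
    then show "C = D" by blast
  qed simp
  ultimately have "(\<Inter>j\<in>S. setpow (irr (A j) v) s) = setpow (\<Inter>j\<in>S. irr (A j) v) s \<longleftrightarrow> ?L s = ?R s" for s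
    by (simp only:)
  moreover have "simis_ideal (mideal (\<Inter>j\<in>S. irr (A j) v) :: ('n, 'k) mpoly set) \<longleftrightarrow>
      (\<forall>s\<ge>1. (\<Inter>j\<in>S. setpow (irr (A j) v) s) = setpow (\<Inter>j\<in>S. irr (A j) v) s)"
    by (rule simis_ideal_antichain_iff[OF fin _ anti]) (use v in \<open>simp_all add: standard_linear_weighting_def\<close>)
  moreover have "simis_ideal (mideal (\<Inter>j\<in>S. irr (A j) (\<lambda>_. 1)) :: ('n, 'k) mpoly set) \<longleftrightarrow>
      (\<forall>s\<ge>1. ?L s = ?R s)"
    by (rule simis_ideal_antichain_iff[OF fin _ anti]) simp_all
  ultimately show ?thesis by simp
qed

section \<open>Squarefree ideals: exponent sets determined by supports\<close>

definition support_closed :: "('n \<Rightarrow>\<^sub>0 nat) set \<Rightarrow> bool" where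
  "support_closed V \<longleftrightarrow>
     (\<forall>c\<in>V. \<forall>d. (\<forall>i. 1 \<le> Poly_Mapping.lookup c i \<longrightarrow> 1 \<le> Poly_Mapping.lookup d i) \<longrightarrow> d \<in> V)"

lemma support_closed_upward: "support_closed V \<Longrightarrow> upward_on UNIV V"
  unfolding support_closed_def upward_on_def by (meson UNIV_I le_trans)

lemma up_closure_support_closed:
  fixes V :: "('n::finite \<Rightarrow>\<^sub>0 nat) set"
  assumes V: "support_closed V"
  shows "up_closure {a \<in> V. \<forall>i. Poly_Mapping.lookup a i \<le> 1} = V"
proof (intro equalityI subsetI)
  fix c assume "c \<in> up_closure {a \<in> V. \<forall>i. Poly_Mapping.lookup a i \<le> 1}"
  then obtain a where a: "a \<in> V" "\<And>i. Poly_Mapping.lookup a i \<le> Poly_Mapping.lookup c i"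
    unfolding up_closure_def by blast
  show "c \<in> V"
    by (rule upward_onD[OF support_closed_upward[OF V] a(1)]) (rule a(2))
next
  fix c assume c: "c \<in> V"
  define a where "a = expo (\<lambda>i. min 1 (Poly_Mapping.lookup c i))"
  have "\<forall>i. 1 \<le> Poly_Mapping.lookup c i \<longrightarrow> 1 \<le> Poly_Mapping.lookup a i" by (simp add: a_def)
  then have "a \<in> V" using V c unfolding support_closed_def by blast
  moreover have "\<forall>i. Poly_Mapping.lookup a i \<le> 1" "\<forall>i. Poly_Mapping.lookup a i \<le> Poly_Mapping.lookup c i"
    by (auto simp: a_def)
  ultimately show "c \<in> up_closure {a \<in> V. \<forall>i. Poly_Mapping.lookup a i \<le> 1}"
    unfolding up_closure_def by blast
qed

lemma squarefree_monomial_ideal_iff: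
  "squarefree_monomial_ideal (J :: ('n::{finite,linorder}, 'k::field) mpoly set) \<longleftrightarrow>
     (\<exists>V. support_closed V \<and> J = mideal V)"
proof
  assume "squarefree_monomial_ideal J"
  then obtain M where M: "\<And>a i. a \<in> M \<Longrightarrow> Poly_Mapping.lookup a i \<le> 1" and J: "J = mideal (up_closure M)"
    unfolding squarefree_monomial_ideal_def monomial_ideal_gen_eq by blast
  have "d \<in> up_closure M" if c: "c \<in> up_closure M" and
    d: "\<forall>i. 1 \<le> Poly_Mapping.lookup c i \<longrightarrow> 1 \<le> Poly_Mapping.lookup d i" for c d
  proof -
    obtain a where a: "a \<in> M" "\<And>i. Poly_Mapping.lookup a i \<le> Poly_Mapping.lookup c i"
      using c unfolding up_closure_def by blast
    have "Poly_Mapping.lookup a i \<le> Poly_Mapping.lookup d i" for i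
      using M[OF a(1), of i] a(2)[of i] d[rule_format, of i] by linarith
    then show ?thesis using a(1) unfolding up_closure_def by blast
  qed
  then have "support_closed (up_closure M)" unfolding support_closed_def by blast
  then show "\<exists>V. support_closed V \<and> J = mideal V" using J by (intro exI conjI)
next
  assume "\<exists>V. support_closed V \<and> J = mideal V"
  then obtain V where V: "support_closed V" and J: "J = mideal V" by (elim exE conjE)
  show "squarefree_monomial_ideal J"
    unfolding squarefree_monomial_ideal_def monomial_ideal_gen_eq J
  proof (intro exI conjI)
    show "\<forall>a\<in>{a \<in> V. \<forall>i. Poly_Mapping.lookup a i \<le> 1}. \<forall>i. Poly_Mapping.lookup a i \<le> 1" by blast
    show "mideal V = mideal (up_closure {a \<in> V. \<forall>i. Poly_Mapping.lookup a i \<le> 1})"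
      unfolding up_closure_support_closed[OF V] ..
  qed
qed

lemma support_closed_Inter_irr:
  fixes A :: "'j \<Rightarrow> 'n set"
  shows "support_closed (\<Inter>j\<in>S. irr (A j) (\<lambda>_. 1))"
  unfolding support_closed_def
proof (intro ballI allI impI INT_I)
  fix c d :: "'n \<Rightarrow>\<^sub>0 nat" and j
  assume c: "c \<in> (\<Inter>j\<in>S. irr (A j) (\<lambda>_. 1))" and j: "j \<in> S" and
    d: "\<forall>i. 1 \<le> Poly_Mapping.lookup c i \<longrightarrow> 1 \<le> Poly_Mapping.lookup d i"
  then obtain i where "i \<in> A j" "1 \<le> Poly_Mapping.lookup c i"
    unfolding irr_def by blast
  then show "d \<in> irr (A j) (\<lambda>_. 1)" using d unfolding irr_def by blast
qed

section \<open>Equality of the weights\<close>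

text \<open>For the components \<open>(x\<^sup>p, y\<^sup>q)\<close>, \<open>(x\<^sup>p', z\<^sup>r)\<close>, \<open>(y\<^sup>q', z\<^sup>r')\<close> on a triangle, \<open>tri_wit\<close> says that the
  monomial with exponents \<open>(a, b, c)\<close> lies in all three squares but not in the square of the
  intersection.\<close>

definition tri_mem :: "nat \<Rightarrow> nat \<Rightarrow> nat \<Rightarrow> nat \<Rightarrow> nat \<Rightarrow> nat \<Rightarrow> nat \<Rightarrow> nat \<Rightarrow> nat \<Rightarrow> bool" where
  "tri_mem p q p' r q' r' a b c \<longleftrightarrow> (p \<le> a \<or> q \<le> b) \<and> (p' \<le> a \<or> r \<le> c) \<and> (q' \<le> b \<or> r' \<le> c)"

definition sq_mem :: "nat \<Rightarrow> nat \<Rightarrow> nat \<Rightarrow> nat \<Rightarrow> bool" where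
  "sq_mem p q a b \<longleftrightarrow> 2 * p \<le> a \<or> (p \<le> a \<and> q \<le> b) \<or> 2 * q \<le> b"

definition tri_wit :: "nat \<Rightarrow> nat \<Rightarrow> nat \<Rightarrow> nat \<Rightarrow> nat \<Rightarrow> nat \<Rightarrow> nat \<Rightarrow> nat \<Rightarrow> nat \<Rightarrow> bool" where
  "tri_wit p q p' r q' r' a b c \<longleftrightarrow> sq_mem p q a b \<and> sq_mem p' r a c \<and> sq_mem q' r' b c \<and>
     (\<forall>a1 b1 c1 a2 b2 c2. tri_mem p q p' r q' r' a1 b1 c1 \<longrightarrow> tri_mem p q p' r q' r' a2 b2 c2 \<longrightarrow>
        a = a1 + a2 \<longrightarrow> b = b1 + b2 \<longrightarrow> c = c1 + c2 \<longrightarrow> False)"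

lemma tri_mem_rot: "tri_mem p q p' r q' r' a b c \<longleftrightarrow> tri_mem r p' r' q' p q c a b"
  unfolding tri_mem_def by blast

lemma sq_mem_swap: "sq_mem p q a b \<longleftrightarrow> sq_mem q p b a"
  unfolding sq_mem_def by blast

text \<open>A rotation of the triangle: z takes the role of x, x that of y, and y that of z. It
  makes \<open>tri_wit_step\<close> available at every corner.\<close>

lemma tri_wit_rot: "tri_wit r p' r' q' p q c a b \<Longrightarrow> tri_wit p q p' r q' r' a b c"
  unfolding tri_wit_def tri_mem_rot[of p q p' r q' r'] sq_mem_swap[of r p' c a] sq_mem_swap[of r' q' c b]
  by metis

text \<open>The case without a component on {y, z}. No y at all forces x^p into both factors; z^r
  serves only one factor, so the other needs x^p'.\<close>

lemma no_edge_wit: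
  fixes p q p' r :: nat
  assumes "1 \<le> p" "p < p'" "1 \<le> q" "1 \<le> r"
  shows "sq_mem p q (max (2 * p) p') 0" and "sq_mem p' r (max (2 * p) p') r"
    and "\<lbrakk>p \<le> a1 \<or> q \<le> b1; p' \<le> a1 \<or> r \<le> c1; p \<le> a2 \<or> q \<le> b2; p' \<le> a2 \<or> r \<le> c2;
      max (2 * p) p' = a1 + a2; 0 = b1 + b2; r = c1 + c2\<rbrakk> \<Longrightarrow> False"
  using assms by (auto simp: sq_mem_def max_def split: if_splits)

text \<open>The exponents \<open>q - 1\<close> and \<open>2 * r - 1\<close> are the largest for
  which y still serves neither factor and z at most one. The disjunction among the hypotheses says
  exactly that the square of the third component contains y^(q-1) z^(2r-1).\<close>

lemma tri_wit_step:
  assumes "1 \<le> p" "p < p'" "1 \<le> q" "1 \<le> r" "2 * q' < q \<or> r' < r \<or> (q' < q \<and> r' < 2 * r)"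
  shows "tri_wit p q p' r q' r' (max (2 * p) p') (q - 1) (2 * r - 1)"
proof -
  have "p \<le> a \<and> (p' \<le> a \<or> r \<le> c)" if "tri_mem p q p' r q' r' a b c" "b \<le> q - 1" for a b c
    using that assms(3) unfolding tri_mem_def by auto
  then have "p \<le> a1 \<and> (p' \<le> a1 \<or> r \<le> c1) \<and> p \<le> a2 \<and> (p' \<le> a2 \<or> r \<le> c2)"
    if "tri_mem p q p' r q' r' a1 b1 c1" "tri_mem p q p' r q' r' a2 b2 c2" "q - 1 = b1 + b2"
    for a1 b1 c1 a2 b2 c2
    using that by (metis le_add1 le_add2)
  moreover have False
    if "p \<le> a1 \<and> (p' \<le> a1 \<or> r \<le> c1) \<and> p \<le> a2 \<and> (p' \<le> a2 \<or> r \<le> c2)"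
      "max (2 * p) p' = a1 + a2" "2 * r - 1 = c1 + c2" for a1 c1 a2 c2
    using that assms(1,2,4) by linarith
  ultimately have "\<forall>a1 b1 c1 a2 b2 c2. tri_mem p q p' r q' r' a1 b1 c1 \<longrightarrow>
      tri_mem p q p' r q' r' a2 b2 c2 \<longrightarrow> max (2 * p) p' = a1 + a2 \<longrightarrow> q - 1 = b1 + b2 \<longrightarrow>
      2 * r - 1 = c1 + c2 \<longrightarrow> False"
    by blast
  moreover have "sq_mem p q (max (2 * p) p') (q - 1)" "sq_mem p' r (max (2 * p) p') (2 * r - 1)"
    "sq_mem q' r' (q - 1) (2 * r - 1)"
    using assms unfolding sq_mem_def by linarith+
  ultimately show ?thesis
    unfolding tri_wit_def by blast
qed

lemma tri_wit_exists:
  assumes "1 \<le> p" "p < p'" "1 \<le> q" "1 \<le> r" "1 \<le> q'" "1 \<le> r'"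
  shows "\<exists>a b c. tri_wit p q p' r q' r' a b c"
proof -
  \<comment> \<open>Cases 1, 3 and 4 are \<open>tri_wit_step\<close> at x, z and y. If 1 fails, then
    r <= r', and r' = r forces q <= q'. If r < r', failure of 3 gives 2q' <= q and failure of 1
    gives q <= 2q', so q = 2q'; then failure of 1 and 4 likewise pins r' to 2r.\<close>
  consider "2 * q' < q \<or> r' < r \<or> (q' < q \<and> r' < 2 * r)"
    | "r' = r" "q \<le> q'"
    | "r < r'" "2 * p < p' \<or> q < q' \<or> (p < p' \<and> q < 2 * q')"
    | "q' < q" "2 * r < r' \<or> p' < p \<or> (r < r' \<and> p' < 2 * p)"
    | "r' = 2 * r" "q = 2 * q'" "p' \<le> 2 * p"
    using assms by linarith
  then show ?thesis
  proof cases
    case 1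
    then show ?thesis using tri_wit_step assms by blast
  next
    case 2
    \<comment> \<open>The component (x^p', z^r) makes one factor take all of x and the other all of
      z. The first then needs y^q' for the third component and the second y^q for the first, but
      only y^q' is available.\<close>
    have "tri_wit p q p' r q' r' p' q' r"
      using 2 assms(1-5) unfolding tri_wit_def tri_mem_def sq_mem_def by auto
    then show ?thesis by blast
  next
    case 3
    then show ?thesis using tri_wit_rot[OF tri_wit_step[of r r' p' q' p q]] assms by fastforce
  next
    case 4
    then show ?thesis
      using tri_wit_rot[OF tri_wit_rot[OF tri_wit_step[of q' q r' p r p']]] assms by fastforce
  next
    case 5
    \<comment> \<open>Again one factor takes all of x and the other all of z. The latter needs all
      of y^q, which leaves the former outside the third component. The square of that component
      holds the monomial because q = 2q'.\<close>
    have "tri_wit p q p' r q' r' p' q r"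
      using 5 assms(1-5) unfolding tri_wit_def tri_mem_def sq_mem_def by auto
    then show ?thesis by blast
  qed
qed

section \<open>From witnesses on three variables to exponents in all variables\<close>

lemma setpow_2:
  assumes "upward_on UNIV U"
  shows "setpow U 2 = {a + b | a b. a \<in> U \<and> b \<in> U}"
proof -
  have "setpow U (Suc 0) = U"
  proof (intro equalityI subsetI)
    fix c assume "c \<in> setpow U (Suc 0)"
    then show "c \<in> U" using upward_on_add(2)[OF assms] by auto
  next
    fix c assume "c \<in> U"
    then have "c = 0 + c \<and> 0 \<in> setpow U 0 \<and> c \<in> U" by simp
    then show "c \<in> setpow U (Suc 0)" unfolding setpow.simps(2) by blast
  qed
  then show ?thesis unfolding numeral_2_eq_2 setpow.simps(2)[of U "Suc 0"] by (simp only:)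
qed

lemma setpow_irr_2I:
  assumes "sq_mem (u s) (u t) (Poly_Mapping.lookup e s) (Poly_Mapping.lookup e t)" "s \<in> A" "t \<in> A" "s \<noteq> t"
  shows "e \<in> setpow (irr A u) 2"
proof -
  have *: "e \<in> setpow (irr A u) 2" if "a \<in> irr A u" "b \<in> irr A u" 
    "\<And>i. Poly_Mapping.lookup a i + Poly_Mapping.lookup b i \<le> Poly_Mapping.lookup e i" for a b
  proof -
    have up: "upward_on UNIV (irr A u)" by (rule upward_on_UNIV[OF upward_on_irr])
    have "a + b \<in> setpow (irr A u) 2" using that setpow_2[OF up] by blast
    then show ?thesis
      by (rule upward_onD[OF upward_on_setpow[OF up]]) (simp add: lookup_add that(3))
  qed
  have mem: "Poly_Mapping.single i (u i) \<in> irr A u" if "i \<in> A" for i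
    using that unfolding irr_def by (intro CollectI bexI[of _ i]) simp_all
  consider "2 * u s \<le> Poly_Mapping.lookup e s" | "u s \<le> Poly_Mapping.lookup e s" "u t \<le> Poly_Mapping.lookup e t"
    | "2 * u t \<le> Poly_Mapping.lookup e t"
    using assms(1) unfolding sq_mem_def by blast
  then show ?thesis
  proof cases
    case 1
    then show ?thesis
      by (intro *[OF mem[OF assms(2)] mem[OF assms(2)]]) (auto simp: lookup_single when_def mult_2)
  next
    case 2
    then show ?thesis
      using assms(4) by (intro *[OF mem[OF assms(2)] mem[OF assms(3)]]) (auto simp: lookup_single when_def)
  next
    case 3
    then show ?thesis
      by (intro *[OF mem[OF assms(3)] mem[OF assms(3)]]) (auto simp: lookup_single when_def mult_2)
  qed
qed

lemma square_weights_le: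
  fixes A :: "'j \<Rightarrow> 'n::{finite,linorder} set"
  assumes fin: "finite S" and u: "\<And>j i. j \<in> S \<Longrightarrow> i \<in> A j \<Longrightarrow> 1 \<le> u j i"
    and anti: "\<And>j k. j \<in> S \<Longrightarrow> k \<in> S \<Longrightarrow> A j \<subseteq> A k \<Longrightarrow> j = k"
    and card: "\<And>j. j \<in> S \<Longrightarrow> card (A j) \<le> 2"
    and eq: "(\<Inter>j\<in>S. setpow (irr (A j) (u j)) 2) \<subseteq> setpow (\<Inter>j\<in>S. irr (A j) (u j)) 2"
    and j: "j \<in> S" "x \<in> A j" and k: "k \<in> S" "x \<in> A k"
  shows "u k x \<le> u j x"
proof (rule ccontr)
  assume less: "\<not> u k x \<le> u j x"
  then have jk: "\<not> A j \<subseteq> A k" "\<not> A k \<subseteq> A j"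
    using anti[OF j(1) k(1)] anti[OF k(1) j(1)] by (metis order_refl)+
  \<comment> \<open>Incomparability also excludes one-element sets, so with at most two elements
    each, the two supports are the edges {x, y} and {x, z}.\<close>
  then obtain y z where y: "y \<in> A j" "y \<notin> A k" and z: "z \<in> A k" "z \<notin> A j" by blast
  have ne: "x \<noteq> y" "x \<noteq> z" "y \<noteq> z" using j k y z by auto
  have Aj: "A j = {x, y}"
    using card_seteq[of "A j" "{x, y}"] card[OF j(1)] j(2) y(1) ne(1) by simp
  have Ak: "A k = {x, z}"
    using card_seteq[of "A k" "{x, z}"] card[OF k(1)] k(2) z(1) ne(2) by simp
  define U where "U = (\<Inter>j\<in>S. irr (A j) (u j))"
  have U: "upward_on UNIV U"
    unfolding U_def by (intro upward_on_Inter upward_on_UNIV[OF upward_on_irr])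
  \<comment> \<open>At least twice every weight: a single variable outside {x, y, z} then puts the
    monomial \<open>e\<close> into the square of each component that involves it.\<close>
  define N where "N = 2 * (\<Sum>m\<in>S. \<Sum>i\<in>UNIV. u m i)"
  have N: "2 * u m i \<le> N" if "m \<in> S" for m i
  proof -
    have "u m i \<le> (\<Sum>i\<in>UNIV. u m i)" by (rule member_le_sum) auto
    also have "\<dots> \<le> (\<Sum>m\<in>S. \<Sum>i\<in>UNIV. u m i)" by (rule member_le_sum) (use fin that in auto)
    finally show ?thesis by (simp add: N_def)
  qed
  define e where "e a b c = expo (\<lambda>t. if t = x then a else if t = y then b else if t = z then c else N)" for a b c
  have e: "Poly_Mapping.lookup (e a b c) x = a" "Poly_Mapping.lookup (e a b c) y = b"
    "Poly_Mapping.lookup (e a b c) z = c" for a b c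
    using ne by (auto simp: e_def)
  have third: "A m = {y, z}" if m: "m \<in> S" "m \<noteq> j" "m \<noteq> k" "A m \<subseteq> {x, y, z}" for m
  proof -
    have "\<not> A m \<subseteq> {x, y}" "\<not> A m \<subseteq> {x, z}"
      using anti[OF m(1) j(1)] anti[OF m(1) k(1)] m(2,3) unfolding Aj Ak by blast+
    then have "y \<in> A m" "z \<in> A m" using m(4) by auto
    then show ?thesis using card_seteq[of "A m" "{y, z}"] card[OF m(1)] ne(3) by simp
  qed
  have mem: "e a b c \<in> setpow U 2"
    if sq: "sq_mem (u j x) (u j y) a b" "sq_mem (u k x) (u k z) a c"
      "\<And>m. m \<in> S \<Longrightarrow> A m = {y, z} \<Longrightarrow> sq_mem (u m y) (u m z) b c" for a b c
  proof -
    have "e a b c \<in> setpow (irr (A m) (u m)) 2" if m: "m \<in> S" for m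
    proof (cases "A m \<subseteq> {x, y, z}")
      case True
      consider "m = j" | "m = k" | "A m = {y, z}" using third[OF m] True by blast
      then show ?thesis
      proof cases
        case 1
        show ?thesis
          unfolding 1 by (rule setpow_irr_2I[of "u j" x y]) (simp_all only: e sq Aj insert_iff ne simp_thms)
      next
        case 2
        show ?thesis
          unfolding 2 by (rule setpow_irr_2I[of "u k" x z]) (simp_all only: e sq Ak insert_iff ne simp_thms)
      next
        case 3
        show ?thesis
          by (rule setpow_irr_2I[of "u m" y z]) (simp_all only: e sq(3)[OF m 3] 3 insert_iff ne simp_thms)
      qed
    next
      case False
      then obtain i where i: "i \<in> A m" "i \<noteq> x" "i \<noteq> y" "i \<noteq> z" by blast
      have le: "2 * u m i \<le> Poly_Mapping.lookup (e a b c) i" using N[OF m] i by (simp add: e_def)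
      have single: "Poly_Mapping.single i (2 * u m i) \<in> setpow (irr (A m) (u m)) 2"
      proof -
        have "Poly_Mapping.single i (u m i) \<in> irr (A m) (u m)"
          unfolding irr_def using i(1) by (intro CollectI bexI[of _ i]) simp_all
        moreover have "Poly_Mapping.single i (2 * u m i) = Poly_Mapping.single i (u m i) + Poly_Mapping.single i (u m i)"
          by (simp add: mult_2 single_add)
        ultimately show ?thesis
          unfolding setpow_2[OF upward_on_UNIV[OF upward_on_irr]] by blast
      qed
      show ?thesis
        by (rule upward_onD[OF upward_on_setpow[OF upward_on_UNIV[OF upward_on_irr]] single])
          (use le in \<open>auto simp: lookup_single when_def\<close>)
    qed
    then show ?thesis using eq unfolding U_def by blast
  qed
  have split: "\<exists>e1\<in>U. \<exists>e2\<in>U. e a b c = e1 + e2" if "e a b c \<in> setpow U 2" for a b c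
    using that unfolding setpow_2[OF U] by blast
  have irrU: "u j x \<le> Poly_Mapping.lookup e1 x \<or> u j y \<le> Poly_Mapping.lookup e1 y"
    "u k x \<le> Poly_Mapping.lookup e1 x \<or> u k z \<le> Poly_Mapping.lookup e1 z" if "e1 \<in> U" for e1
  proof -
    have "e1 \<in> irr (A j) (u j)" "e1 \<in> irr (A k) (u k)"
      using that j(1) k(1) unfolding U_def by blast+
    then show "u j x \<le> Poly_Mapping.lookup e1 x \<or> u j y \<le> Poly_Mapping.lookup e1 y"
      "u k x \<le> Poly_Mapping.lookup e1 x \<or> u k z \<le> Poly_Mapping.lookup e1 z"
      unfolding irr_def Aj Ak by simp_all
  qed
  have pos: "1 \<le> u j x" "1 \<le> u j y" "1 \<le> u k z"
    by (rule u[OF j], rule u[OF j(1) y(1)], rule u[OF k(1) z(1)])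
  show False
  proof (cases "\<exists>l\<in>S. A l = {y, z}")
    case True
    then obtain l where l: "l \<in> S" "A l = {y, z}" by blast
    have lm: "m = l" if "m \<in> S" "A m = {y, z}" for m
      using anti[OF that(1) l(1)] that(2) l(2) by simp
    have "1 \<le> u l y" "1 \<le> u l z" using u[OF l(1)] l(2) by auto
    then obtain a b c where w: "tri_wit (u j x) (u j y) (u k x) (u k z) (u l y) (u l z) a b c"
      using tri_wit_exists[of "u j x" "u k x" "u j y" "u k z" "u l y" "u l z"] pos less
      unfolding not_le by blast
    then have "e a b c \<in> setpow U 2"
      using lm unfolding tri_wit_def by (intro mem) blast+
    then obtain e1 e2 where E: "e1 \<in> U" "e2 \<in> U" "e a b c = e1 + e2" using split by blast
    have "tri_mem (u j x) (u j y) (u k x) (u k z) (u l y) (u l z) (Poly_Mapping.lookup e' x)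
        (Poly_Mapping.lookup e' y) (Poly_Mapping.lookup e' z)" if "e' \<in> U" for e'
    proof -
      have "u l y \<le> Poly_Mapping.lookup e' y \<or> u l z \<le> Poly_Mapping.lookup e' z"
        using that l(1) unfolding U_def irr_def by (auto simp: l(2))
      then show ?thesis using irrU[OF that] unfolding tri_mem_def by blast
    qed
    moreover have "a = Poly_Mapping.lookup e1 x + Poly_Mapping.lookup e2 x"
      "b = Poly_Mapping.lookup e1 y + Poly_Mapping.lookup e2 y"
      "c = Poly_Mapping.lookup e1 z + Poly_Mapping.lookup e2 z"
      using E(3) e[of a b c] by (simp_all add: lookup_add)
    ultimately show False
      using w E(1,2) unfolding tri_wit_def by blast
  next
    case False
    \<comment> \<open>Without a component on {y, z}, the third condition of \<open>mem\<close> is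
      vacuous, so \<open>no_edge_wit\<close> suffices.\<close>
    define a where "a = max (2 * u j x) (u k x)"
    have less': "u j x < u k x" using less by simp
    have "e a 0 (u k z) \<in> setpow U 2"
      using no_edge_wit(1,2)[OF pos(1) less' pos(2,3)] False unfolding a_def by (intro mem) auto
    then obtain e1 e2 where E: "e1 \<in> U" "e2 \<in> U" "e a 0 (u k z) = e1 + e2" using split by blast
    have "a = Poly_Mapping.lookup e1 x + Poly_Mapping.lookup e2 x"
      "0 = Poly_Mapping.lookup e1 y + Poly_Mapping.lookup e2 y"
      "u k z = Poly_Mapping.lookup e1 z + Poly_Mapping.lookup e2 z"
      using E(3) e[of a 0 "u k z"] by (simp_all add: lookup_add)
    then show False
      using no_edge_wit(3)[OF pos(1) less' pos(2,3)] irrU[OF E(1)] irrU[OF E(2)] unfolding a_def by blast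
  qed
qed

theorem theorem4p9:
  fixes I :: "('n::{finite,linorder}, 'k::field) mpoly set"
    and r :: nat and A :: "nat \<Rightarrow> 'n set" and w :: "nat \<Rightarrow> 'n \<Rightarrow> nat"
  assumes "monomial_ideal I" and "I \<noteq> {0}" and "I \<noteq> UNIV"
    and "embedded_primes type_ring I = {}"
    and "minimal_irreducible_decomposition I r A w"
    and "\<forall>p \<in> associated_primes type_ring I. height type_ring p = 2"
  shows "simis_ideal I \<longleftrightarrow>
    (\<exists>(J :: ('n, 'k) mpoly set) v. squarefree_monomial_ideal J \<and> simis_ideal J \<and>
       standard_linear_weighting v \<and> I = weighted_ideal v J)"
proof -
  define S where "S = {1..r}"
  have fin: "finite S" by (simp add: S_def)
  note dec = assms(5)[unfolded minimal_irreducible_decomposition_def irreducible_monomial_ideal_eq, folded S_def]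
  have w: "1 \<le> w j i" if "j \<in> S" "i \<in> A j" for j i
    using dec that by blast
  have I: "I = mideal (\<Inter>j\<in>S. irr (A j) (w j))"
    unfolding mideal_Inter using dec by blast
  have inj: "j = k" if "j \<in> S" "k \<in> S" "A j = A k" for j k
  proof -
    have rad: "radical_ideal type_ring (mideal (irr (A j) (w j)) :: ('n, 'k) mpoly set) = var_ideal (A j)"
      if "j \<in> S" for j
      by (rule radical_ideal_irr) (use w that in blast)
    have "inj_on (\<lambda>j. radical_ideal type_ring (mideal (irr (A j) (w j)) :: ('n, 'k) mpoly set)) S"
      using dec by blast
    moreover have "radical_ideal type_ring (mideal (irr (A j) (w j)) :: ('n, 'k) mpoly set) =
        radical_ideal type_ring (mideal (irr (A k) (w k)))"
      unfolding rad[OF that(1)] rad[OF that(2)] unfolding that(3) by (rule refl)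
    ultimately show ?thesis
      using that(1,2) by (rule inj_onD)
  qed
  have ass: "(var_ideal (A j) :: ('n, 'k) mpoly set) \<in> associated_primes type_ring I" if j: "j \<in> S" for j
  proof -
    have "I \<noteq> mideal (\<Inter>k\<in>S - {j}. irr (A k) (w k))"
      unfolding mideal_Inter using dec j by blast
    then have "(\<Inter>j\<in>S. irr (A j) (w j)) \<noteq> (\<Inter>k\<in>S - {j}. irr (A k) (w k))"
      using I by metis
    then obtain c where c: "c \<in> (\<Inter>k\<in>S - {j}. irr (A k) (w k))" "c \<notin> irr (A j) (w j)"
      using j by blast
    show ?thesis
      unfolding I by (rule var_ideal_associated_prime[OF j w[OF j] c])
  qed
  have anti: "j = k" if jk: "j \<in> S" "k \<in> S" "A j \<subseteq> A k" for j k
  proof (rule ccontr)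
    assume "j \<noteq> k"
    then have "A k \<noteq> A j" using inj jk by metis
    then have "(var_ideal (A j) :: ('n, 'k) mpoly set) \<subset> var_ideal (A k)"
      unfolding less_le_not_le var_ideal_subset_iff using jk(3) by blast
    then have "(var_ideal (A k) :: ('n, 'k) mpoly set) \<in> embedded_primes type_ring I"
      unfolding embedded_primes_def using ass[OF jk(1)] ass[OF jk(2)] by blast
    then show False using assms(4) by simp
  qed
  have card: "card (A j) \<le> 2" if "j \<in> S" for j
  proof -
    have "height type_ring (var_ideal (A j) :: ('n, 'k) mpoly set) = 2"
      using assms(6) ass[OF that] by (rule bspec)
    then have "enat (card (A j)) \<le> enat 2"
      using card_le_height[of "A j", where 'k = 'k] by (simp only: numeral_eq_enat)
    then show ?thesis by (simp only: enat_ord_simps)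
  qed
  show ?thesis
  proof
    assume "simis_ideal I"
    then have "\<forall>s\<ge>1. (\<Inter>j\<in>S. setpow (irr (A j) (w j)) s) = setpow (\<Inter>j\<in>S. irr (A j) (w j)) s"
      unfolding I by (subst (asm) simis_ideal_antichain_iff[OF fin w anti])
    then have eq: "(\<Inter>j\<in>S. setpow (irr (A j) (w j)) 2) \<subseteq> setpow (\<Inter>j\<in>S. irr (A j) (w j)) 2"
      by (rule allE[of _ 2]) simp
    have same: "w j i = w k i" if "j \<in> S" "i \<in> A j" "k \<in> S" "i \<in> A k" for j k i
    proof -
      have "w k i \<le> w j i" if "j \<in> S" "i \<in> A j" "k \<in> S" "i \<in> A k" for j k
        by (rule square_weights_le[OF fin w anti card eq that])
      from this[OF that] this[OF that(3,4,1,2)] show ?thesis by simp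
    qed
    \<comment> \<open>By \<open>same\<close> the choice of \<open>j\<close> does not matter. A
      variable in no component gets 1, since a weighting must be positive everywhere.\<close>
    define v where "v i = (if \<exists>j\<in>S. i \<in> A j then w (SOME j. j \<in> S \<and> i \<in> A j) i else 1)" for i
    have v: "v i = w j i" if "j \<in> S" "i \<in> A j" for i j
    proof -
      have "(SOME j. j \<in> S \<and> i \<in> A j) \<in> S \<and> i \<in> A (SOME j. j \<in> S \<and> i \<in> A j)"
        by (rule someI[of _ j]) (use that in blast)
      then show ?thesis using same[OF _ _ that] that unfolding v_def by metis
    qed
    have "1 \<le> v i" for i
    proof (cases "\<exists>j\<in>S. i \<in> A j")
      case True
      then show ?thesis using v w by metis
    qed (simp add: v_def)
    then have vw: "standard_linear_weighting v" by (simp add: standard_linear_weighting_def)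
    have "irr (A j) (w j) = irr (A j) v" if "j \<in> S" for j
      unfolding irr_def using v[OF that] by auto
    then have Iv: "I = mideal (\<Inter>j\<in>S. irr (A j) v)" unfolding I by simp
    define V where "V = (\<Inter>j\<in>S. irr (A j) (\<lambda>_. 1))"
    have V: "support_closed V"
      unfolding V_def by (rule support_closed_Inter_irr)
    then have "squarefree_monomial_ideal (mideal V :: ('n, 'k) mpoly set)"
      unfolding squarefree_monomial_ideal_iff by (intro exI[of _ V]) simp
    moreover have "simis_ideal (mideal V :: ('n, 'k) mpoly set)"
      using \<open>simis_ideal I\<close> unfolding Iv V_def
      by (subst (asm) simis_ideal_weighting_iff[OF fin anti vw])
    moreover have "I = weighted_ideal v (mideal V)"
    proof -
      have "(\<Inter>j\<in>S. irr (A j) v) = {d. div_exponent v d \<in> V}"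
        unfolding V_def irr_eq_div_exponent[OF vw] by blast
      then show ?thesis
        unfolding Iv weighted_ideal_mideal[OF vw support_closed_upward[OF V]] by simp
    qed
    ultimately show "\<exists>(J :: ('n, 'k) mpoly set) v. squarefree_monomial_ideal J \<and> simis_ideal J \<and>
       standard_linear_weighting v \<and> I = weighted_ideal v J"
      using vw by (intro exI conjI)
  next
    assume "\<exists>(J :: ('n, 'k) mpoly set) v. squarefree_monomial_ideal J \<and> simis_ideal J \<and>
       standard_linear_weighting v \<and> I = weighted_ideal v J"
    then obtain J :: "('n, 'k) mpoly set" and v where J: "squarefree_monomial_ideal J" "simis_ideal J"
      and vw: "standard_linear_weighting v" and IJ: "I = weighted_ideal v J"
      by blast
    obtain V where V: "support_closed V" and JV: "J = mideal V"
      using J(1) unfolding squarefree_monomial_ideal_iff by (elim exE conjE)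
    have IV: "(\<Inter>j\<in>S. irr (A j) (w j)) = {d. div_exponent v d \<in> V}"
      using IJ unfolding I JV weighted_ideal_mideal[OF vw support_closed_upward[OF V]] mideal_eq_iff .
    \<comment> \<open>Scaling an exponent by \<open>N\<close> keeps its support, because
      \<open>N\<close> is positive, and lifts every positive entry to at least all weights of
      \<open>I\<close>. After scaling, membership in each component of \<open>I\<close> therefore
      depends on the support alone, which identifies \<open>V\<close>.\<close>
    define N where "N = Suc (\<Sum>m\<in>S. \<Sum>i\<in>UNIV. w m i)"
    have N: "w m i \<le> N" if "m \<in> S" for m i
    proof -
      have "w m i \<le> (\<Sum>i\<in>UNIV. w m i)" by (rule member_le_sum) auto
      also have "\<dots> \<le> (\<Sum>m\<in>S. \<Sum>i\<in>UNIV. w m i)" by (rule member_le_sum) (use fin that in auto)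
      finally show ?thesis by (simp add: N_def)
    qed
    have VA: "V = (\<Inter>j\<in>S. irr (A j) (\<lambda>_. 1))"
    proof -
      have "c \<in> V \<longleftrightarrow> c \<in> (\<Inter>j\<in>S. irr (A j) (\<lambda>_. 1))" for c
      proof -
        define d where "d = expo (\<lambda>i. N * Poly_Mapping.lookup c i)"
        have "c \<in> V \<longleftrightarrow> d \<in> V"
        proof -
          have "1 \<le> Poly_Mapping.lookup c i \<longleftrightarrow> 1 \<le> Poly_Mapping.lookup d i" for i
            by (auto simp: d_def N_def Suc_le_eq)
          then show ?thesis using V unfolding support_closed_def by blast
        qed
        also have "\<dots> \<longleftrightarrow> weight_exponent v d \<in> (\<Inter>j\<in>S. irr (A j) (w j))"
          unfolding IV using vw by simp
        also have "\<dots> \<longleftrightarrow> c \<in> (\<Inter>j\<in>S. irr (A j) (\<lambda>_. 1))"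
        proof -
          have "w j i \<le> v i * (N * Poly_Mapping.lookup c i) \<longleftrightarrow> 1 \<le> Poly_Mapping.lookup c i"
            if ji: "j \<in> S" "i \<in> A j" for j i
          proof
            assume "w j i \<le> v i * (N * Poly_Mapping.lookup c i)"
            then show "1 \<le> Poly_Mapping.lookup c i" using w[OF ji] by (cases "Poly_Mapping.lookup c i") auto
          next
            assume "1 \<le> Poly_Mapping.lookup c i"
            then have "1 * (N * 1) \<le> v i * (N * Poly_Mapping.lookup c i)"
              using vw unfolding standard_linear_weighting_def by (intro mult_mono) auto
            then show "w j i \<le> v i * (N * Poly_Mapping.lookup c i)"
              using N[OF ji(1), of i] unfolding mult_1_left mult_1_right by (rule order_trans[rotated])
          qed
          then show ?thesis unfolding irr_def by (simp add: d_def del: One_nat_def)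
        qed
        finally show ?thesis .
      qed
      then show ?thesis by blast
    qed
    \<comment> \<open>With \<open>V\<close> known, \<open>I\<close> has a second description on the
      same supports \<open>A j\<close>, now with the single weighting \<open>v\<close>, and
      \<open>simis_ideal_weighting_iff\<close> applies.\<close>
    have "(\<Inter>j\<in>S. irr (A j) (w j)) = (\<Inter>j\<in>S. irr (A j) v)"
      unfolding IV unfolding VA irr_eq_div_exponent[OF vw] by blast
    then have Iv: "I = mideal (\<Inter>j\<in>S. irr (A j) v)" unfolding I by simp
    show "simis_ideal I"
      using J(2) unfolding Iv JV VA by (subst simis_ideal_weighting_iff[OF fin anti vw])
  qed
qed

end
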